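(* Let $G$ be a Garside group, the group of fractions of a Garside monoid $M$ with Garside element $\delta$. Let $x\in G$, let $y\in U_x$, and let $u,v\in M$ be such that $y^u\in U_x$ and $y^v\in U_x$. Then $y^{u\wedge v}\in U_x$.
   Context: **Garside monoids and groups.** Let $M$ be a (left and right) cancellative monoid. For $a,b\in M$ write $a\preceq b$ if $ac=b$ for some $c\in M$, and $a\succeq b$ if $a=cb$ for some $c\in M$. The (left) gcd $a\wedge b$ and (left) lcm $a\vee b$ are the greatest lower bound and least upper bound with respect to $\preceq$. An atom is an element $x\neq 1$ such that $x=ab$ with $a,b\in M$ implies $a=1$ or $b=1$. $M$ is atomic if it is generated by its atoms and for every $a\in M$ there is a bound $N_a$ such that $a$ is not a product of more than $N_a$ atoms. An element $\delta\in M$ is a Garside element if $\{x\in M: x\preceq\delta\}=\{x\in M:\delta\succeq x\}$ and this set is finite and generates $M$. $M$ is a Garside monoid if it is atomic, has a Garside element $\delta$, and gcd and lcm of any $a,b\in M$ exist (they are then unique). Its group of fractions $G$ is called a Garside group; $M$ embeds in $G$ and is identified with its image. The set of simple elements is $D=\{x\in M: x\preceq\delta\}$. Extend $\preceq$ to $G$ by: $a\preceq b$ iff $a^{-1}b\in M$; the notions $\wedge,\vee$ extend to $G$. Conjugation is $x^c=c^{-1}xc$, and $\tau(x)=x^\delta=\delta^{-1}x\delta$; $\tau$ preserves $M$ and $\preceq$. **Normal form.** For $x\in G$ let $\inf(x)$ be the maximal integer $k$ with $\delta^k\preceq x$, $\sup(x)$ the minimal integer $m$ with $x\preceq\delta^m$,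 and $\mathrm{len}(x)=\sup(x)-\inf(x)\ge 0$. With $k=\inf(x)$, $r=\mathrm{len}(x)$, there are unique $A_1,\dots,A_r\in D$ with $x=\delta^kA_1\cdots A_r$ and $A_i^{-1}\delta\wedge A_{i+1}=1$ for $i=1,\dots,r-1$; this is the normal form of $x$. **Super summit set.** $S_x$ is the set of conjugates $y$ of $x$ in $G$ for which $\inf(y)$ is maximal and $\sup(y)$ is minimal among all conjugates of $x$ (this set is finite and nonempty). **Cycling.** If $x$ has normal form $\delta^kA_1\cdots A_r$, put $\mathbf{c}(x)=x$ if $r=0$ and $\mathbf{c}(x)=x^{\tau^{-k}(A_1)}$ otherwise. Cycling maps $S_x$ to itself. **Ultra summit set.** $U_x=\{y\in S_x:\mathbf{c}^k(y)=y\text{ for some }k>0\}$. *)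

theory Defs
  imports "HOL-Algebra.Divisibility"
begin

section \<open>Garside monoids\<close>

text \<open>
  The library relation \<^const>\<open>factor\<close>, written \<open>a divides\<^bsub>M\<^esub> b\<close>, means \<open>b = a \<otimes> c\<close> for some
  \<open>c\<close>; it makes sense in noncommutative monoids, where it is the prefix order.  Accordingly
  \<^const>\<open>isgcd\<close> and \<^const>\<open>islcm\<close> are the left gcd and the left lcm.
\<close>

abbreviation list_prod :: "('a, 'b) monoid_scheme \<Rightarrow> 'a list \<Rightarrow> 'a" where
  "list_prod M xs \<equiv> foldr (\<otimes>\<^bsub>M\<^esub>) xs \<one>\<^bsub>M\<^esub>"

text \<open>Generation as a monoid, hence without the inverses that the library's \<open>generate\<close> adds.\<close>

definition monoid_generated_by :: "('a, 'b) monoid_scheme \<Rightarrow> 'a set \<Rightarrow> bool" where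
  "monoid_generated_by M S \<longleftrightarrow>
     S \<subseteq> carrier M \<and> carrier M = {list_prod M xs | xs. set xs \<subseteq> S}"

definition atoms :: "('a, 'b) monoid_scheme \<Rightarrow> 'a set" where
  "atoms M = {x \<in> carrier M. x \<noteq> \<one>\<^bsub>M\<^esub> \<and>
     (\<forall>a\<in>carrier M. \<forall>b\<in>carrier M. x = a \<otimes>\<^bsub>M\<^esub> b \<longrightarrow> a = \<one>\<^bsub>M\<^esub> \<or> b = \<one>\<^bsub>M\<^esub>)}"

definition atomic_monoid :: "('a, 'b) monoid_scheme \<Rightarrow> bool" where
  "atomic_monoid M \<longleftrightarrow>
     monoid_generated_by M (atoms M) \<and>
     (\<forall>a\<in>carrier M. \<exists>N::nat. \<forall>xs. set xs \<subseteq> atoms M \<and> list_prod M xs = a \<longrightarrow> length xs \<le> N)"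

definition garside_element :: "('a, 'b) monoid_scheme \<Rightarrow> 'a \<Rightarrow> bool" where
  "garside_element M \<delta> \<longleftrightarrow>
     \<delta> \<in> carrier M \<and>
     {x \<in> carrier M. x divides\<^bsub>M\<^esub> \<delta>} = {x \<in> carrier M. \<exists>c\<in>carrier M. \<delta> = c \<otimes>\<^bsub>M\<^esub> x} \<and>
     finite {x \<in> carrier M. x divides\<^bsub>M\<^esub> \<delta>} \<and>
     monoid_generated_by M {x \<in> carrier M. x divides\<^bsub>M\<^esub> \<delta>}"

locale garside_monoid = monoid_cancel M for M (structure) +
  fixes \<delta>
  assumes atomic: "atomic_monoid M"
    and garside: "garside_element M \<delta>"
    and gcd_exists: "\<lbrakk>a \<in> carrier M; b \<in> carrier M\<rbrakk> \<Longrightarrow> \<exists>d\<in>carrier M. d gcdof a b"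
    and lcm_exists: "\<lbrakk>a \<in> carrier M; b \<in> carrier M\<rbrakk> \<Longrightarrow> \<exists>m\<in>carrier M. m lcmof a b"


section \<open>Garside groups\<close>

text \<open>
  The monoid is identified with its image in the group of fractions, so it appears as a
  submonoid \<open>M\<close> of \<open>G\<close>.  The condition \<open>fractions\<close> says that \<open>G\<close> is the group of fractions
  of \<open>M\<close>, which determines \<open>G\<close> up to a unique isomorphism over \<open>M\<close>.
\<close>

locale garside_group = group G + submonoid M G for G (structure) and M and \<delta> +
  assumes monoid_M: "garside_monoid (G\<lparr>carrier := M\<rparr>) \<delta>"
    and fractions: "carrier G = {a \<otimes> inv b | a b. a \<in> M \<and> b \<in> M}"

definition prefix_order :: "('a, 'b) monoid_scheme \<Rightarrow> 'a set \<Rightarrow> 'a gorder" where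
  "prefix_order G M =
     \<lparr>carrier = carrier G, eq = (=), le = (\<lambda>a b. inv\<^bsub>G\<^esub> a \<otimes>\<^bsub>G\<^esub> b \<in> M)\<rparr>"

definition simples :: "('a, 'b) monoid_scheme \<Rightarrow> 'a set \<Rightarrow> 'a \<Rightarrow> 'a set" where
  "simples G M \<delta> = {x \<in> M. x \<sqsubseteq>\<^bsub>prefix_order G M\<^esub> \<delta>}"

definition conjugate :: "('a, 'b) monoid_scheme \<Rightarrow> 'a \<Rightarrow> 'a \<Rightarrow> 'a" where
  "conjugate G x c = inv\<^bsub>G\<^esub> c \<otimes>\<^bsub>G\<^esub> x \<otimes>\<^bsub>G\<^esub> c"

definition conjugates :: "('a, 'b) monoid_scheme \<Rightarrow> 'a \<Rightarrow> 'a set" where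
  "conjugates G x = {conjugate G x c | c. c \<in> carrier G}"

text \<open>The integer power \<open>\<tau>\<^sup>j\<close> of \<open>\<tau>(x) = \<delta>\<^sup>-\<^sup>1 x \<delta>\<close>, which is conjugation by \<open>\<delta>\<^sup>j\<close>.\<close>

definition tau_pow :: "('a, 'b) monoid_scheme \<Rightarrow> 'a \<Rightarrow> int \<Rightarrow> 'a \<Rightarrow> 'a" where
  "tau_pow G \<delta> j x = conjugate G x (\<delta> [^]\<^bsub>G\<^esub> j)"


section \<open>Normal form\<close>

definition garside_inf :: "('a, 'b) monoid_scheme \<Rightarrow> 'a set \<Rightarrow> 'a \<Rightarrow> 'a \<Rightarrow> int" where
  "garside_inf G M \<delta> x = (GREATEST k::int. \<delta> [^]\<^bsub>G\<^esub> k \<sqsubseteq>\<^bsub>prefix_order G M\<^esub> x)"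

definition garside_sup :: "('a, 'b) monoid_scheme \<Rightarrow> 'a set \<Rightarrow> 'a \<Rightarrow> 'a \<Rightarrow> int" where
  "garside_sup G M \<delta> x = (LEAST m::int. x \<sqsubseteq>\<^bsub>prefix_order G M\<^esub> \<delta> [^]\<^bsub>G\<^esub> m)"

definition garside_len :: "('a, 'b) monoid_scheme \<Rightarrow> 'a set \<Rightarrow> 'a \<Rightarrow> 'a \<Rightarrow> int" where
  "garside_len G M \<delta> x = garside_sup G M \<delta> x - garside_inf G M \<delta> x"

text \<open>
  \<open>is_normal_form G M \<delta> x As\<close>: the list \<open>As\<close> consists of the factors \<open>A\<^sub>1, \<dots>, A\<^sub>r\<close> (indexed
  from \<open>0\<close>) of the normal form of \<open>x\<close>; the exponent of \<open>\<delta>\<close> is \<open>garside_inf G M \<delta> x\<close>.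
\<close>

definition is_normal_form ::
    "('a, 'b) monoid_scheme \<Rightarrow> 'a set \<Rightarrow> 'a \<Rightarrow> 'a \<Rightarrow> 'a list \<Rightarrow> bool" where
  "is_normal_form G M \<delta> x As \<longleftrightarrow>
     int (length As) = garside_len G M \<delta> x \<and>
     set As \<subseteq> simples G M \<delta> \<and>
     x = \<delta> [^]\<^bsub>G\<^esub> garside_inf G M \<delta> x \<otimes>\<^bsub>G\<^esub> list_prod G As \<and>
     (\<forall>i. Suc i < length As \<longrightarrow>
        (inv\<^bsub>G\<^esub> (As ! i) \<otimes>\<^bsub>G\<^esub> \<delta>) \<sqinter>\<^bsub>prefix_order G M\<^esub> (As ! Suc i) = \<one>\<^bsub>G\<^esub>)"

definition normal_form :: "('a, 'b) monoid_scheme \<Rightarrow> 'a set \<Rightarrow> 'a \<Rightarrow> 'a \<Rightarrow> 'a list" where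
  "normal_form G M \<delta> x = (THE As. is_normal_form G M \<delta> x As)"


section \<open>Cycling, super summit sets and ultra summit sets\<close>

definition cycling :: "('a, 'b) monoid_scheme \<Rightarrow> 'a set \<Rightarrow> 'a \<Rightarrow> 'a \<Rightarrow> 'a" where
  "cycling G M \<delta> x =
     (if garside_len G M \<delta> x = 0 then x
      else conjugate G x (tau_pow G \<delta> (- garside_inf G M \<delta> x) (hd (normal_form G M \<delta> x))))"

definition super_summit_set :: "('a, 'b) monoid_scheme \<Rightarrow> 'a set \<Rightarrow> 'a \<Rightarrow> 'a \<Rightarrow> 'a set" where
  "super_summit_set G M \<delta> x =
     {y \<in> conjugates G x. \<forall>z\<in>conjugates G x.
        garside_inf G M \<delta> z \<le> garside_inf G M \<delta> y \<and> garside_sup G M \<delta> y \<le> garside_sup G M \<delta> z}"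

definition ultra_summit_set :: "('a, 'b) monoid_scheme \<Rightarrow> 'a set \<Rightarrow> 'a \<Rightarrow> 'a \<Rightarrow> 'a set" where
  "ultra_summit_set G M \<delta> x =
     {y \<in> super_summit_set G M \<delta> x. \<exists>k::nat. k > 0 \<and> (cycling G M \<delta> ^^ k) y = y}"

end

theory Submission
  imports Defs
begin

text \<open>
  Let \<open>k\<close> be the infimum on the super summit set.  There, cycling is conjugation by
  \<open>c(y) = \<delta> \<and> y\<delta>\<^sup>-\<^sup>k\<close>.  If \<open>u\<close> conjugates \<open>y\<close> to \<open>z\<close>, then its transport
  \<open>c(y)\<^sup>-\<^sup>1 u c(z) = c(y)\<^sup>-\<^sup>1 (u\<delta> \<and> yu\<delta>\<^sup>-\<^sup>k)\<close> conjugates the cycling of \<open>y\<close> to the cycling of \<open>z\<close>.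
  Transport preserves meets, \<open>M\<close> and every interval \<open>[1, \<delta>\<^sup>m]\<close>, and the latter are finite.  On the
  pairs \<open>(y', u')\<close> with \<open>u'\<close> in such an interval that conjugate the cycling orbit of \<open>y\<close> into that of
  \<open>z\<close>, transport is injective when both orbits are periodic, so it is a permutation of a finite set.
  Hence \<open>u\<close> and \<open>v\<close> return to themselves under iterated transport; so does \<open>u \<and> v\<close>, and with it
  \<open>y\<close> conjugated by \<open>u \<and> v\<close> returns to itself under iterated cycling.
\<close>

section \<open>Iterated maps and extremal integers\<close>

text \<open>By pigeonhole two iterates of \<open>u\<close> agree, and injectivity on
  \<open>W\<close> cancels their common initial steps, so that the orbit closes up at
  \<open>u\<close> itself.\<close>

lemma funpow_returns:
  assumes "finite W" "inj_on f W" "f ` W \<subseteq> W" "u \<in> W"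
  obtains n :: nat where "n > 0" "(f ^^ n) u = u"
proof -
  have W: "(f ^^ n) u \<in> W" for n
    using assms(3,4) by (induction n) auto
  have "\<not> inj (\<lambda>n. (f ^^ n) u)"
    using finite_subset[OF _ assms(1), of "range (\<lambda>n. (f ^^ n) u)"] W finite_imageD infinite_UNIV_nat
    by blast
  then obtain i j where "i < j" "(f ^^ i) u = (f ^^ j) u"
    unfolding inj_def by (metis linorder_neqE_nat)
  moreover have "i < j \<Longrightarrow> (f ^^ i) u = (f ^^ j) u \<Longrightarrow> (f ^^ (j - i)) u = u" for i j
  proof (induction i arbitrary: j)
    case (Suc i)
    then obtain j' where j: "j = Suc j'" by (cases j) auto
    with Suc.prems have "f ((f ^^ i) u) = f ((f ^^ j') u)" by simp
    then have "(f ^^ i) u = (f ^^ j') u" using W assms(2) by (meson inj_onD)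
    with Suc j show ?case by auto
  qed simp
  ultimately show ?thesis by (intro that[of "j - i"]) simp_all
qed

text \<open>The orbit consists of the first \<open>n\<close> iterates, and on it \<open>f\<close>
  has the left inverse \<open>f ^^ (n - 1)\<close>.\<close>

lemma funpow_periodic_orbit:
  fixes f :: "'a \<Rightarrow> 'a" and n :: nat
  assumes "n > 0" "(f ^^ n) y = y"
  shows "finite (range (\<lambda>i. (f ^^ i) y))" "inj_on f (range (\<lambda>i. (f ^^ i) y))"
proof -
  have "(f ^^ i) y \<in> (\<lambda>i. (f ^^ i) y) ` {..<n}" for i
    using funpow_mod_eq[OF assms(2), of i] assms(1) by (intro image_eqI[of _ _ "i mod n"]) auto
  then have "range (\<lambda>i. (f ^^ i) y) \<subseteq> (\<lambda>i. (f ^^ i) y) ` {..<n}"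
    by (intro image_subsetI)
  then show "finite (range (\<lambda>i. (f ^^ i) y))"
    by (rule finite_subset) (intro finite_imageI finite_lessThan)
  obtain n' where n': "n = Suc n'" using assms(1) by (cases n) simp_all
  have "(f ^^ n') (f z) = z" if z: "z \<in> range (\<lambda>i. (f ^^ i) y)" for z
  proof -
    obtain i where i: "z = (f ^^ i) y" using z by (rule rangeE)
    have "(f ^^ n') (f z) = (f ^^ n) ((f ^^ i) y)" by (simp only: n' i funpow_Suc_right comp_apply)
    also have "\<dots> = (f ^^ (n + i)) y" by (simp only: funpow_add comp_apply)
    also have "n + i = i + n" by (rule add.commute)
    also have "(f ^^ (i + n)) y = (f ^^ i) ((f ^^ n) y)" by (simp only: funpow_add comp_apply)
    finally show ?thesis by (simp only: assms(2) i)
  qed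
  then show "inj_on f (range (\<lambda>i. (f ^^ i) y))" by (rule inj_on_inverseI)
qed

lemma funpow_mult_fixed:
  fixes f :: "'a \<Rightarrow> 'a" and n :: nat
  assumes "(f ^^ n) y = y"
  shows "(f ^^ (n * m)) y = y" "(f ^^ (m * n)) y = y"
proof -
  show "(f ^^ (n * m)) y = y" using assms by (induction m) (simp_all add: funpow_add)
  then show "(f ^^ (m * n)) y = y" by (simp only: mult.commute)
qed

text \<open>\<open>GREATEST\<close> is meaningful only when a maximum exists. Cutting the candidates
  off below at the witness \<open>a\<close> leaves a finite nonempty set, whose \<open>Max\<close>
  is that maximum.\<close>

lemma bounded_int_Greatest:
  fixes P :: "int \<Rightarrow> bool"
  assumes "P a" "\<And>k. P k \<Longrightarrow> k \<le> b"
  shows "P (GREATEST k. P k)" "P k \<Longrightarrow> k \<le> (GREATEST k. P k)"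
proof -
  let ?K = "{k. a \<le> k \<and> P k}"
  have fin: "finite ?K" by (rule finite_subset[of _ "{a..b}"]) (use assms in auto)
  then have max: "Max ?K \<in> ?K" using assms(1) by (intro Max_in) auto
  have le: "k \<le> Max ?K" if "P k" for k
    using Max_ge[OF fin, of k] max that by (cases "a \<le> k") auto
  have eq: "(GREATEST k. P k) = Max ?K"
    using max le by (intro Greatest_equality) auto
  show "P (GREATEST k. P k)" using eq max by simp
  show "P k \<Longrightarrow> k \<le> (GREATEST k. P k)" using eq le by simp
qed

lemma bounded_int_Least:
  fixes P :: "int \<Rightarrow> bool"
  assumes "P a" "\<And>k. P k \<Longrightarrow> b \<le> k"
  shows "P (LEAST k. P k)" "P k \<Longrightarrow> (LEAST k. P k) \<le> k"
proof -
  let ?K = "{k. k \<le> a \<and> P k}"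
  have fin: "finite ?K" by (rule finite_subset[of _ "{b..a}"]) (use assms in auto)
  then have min: "Min ?K \<in> ?K" using assms(1) by (intro Min_in) auto
  have le: "Min ?K \<le> k" if "P k" for k
    using Min_le[OF fin, of k] min that by (cases "k \<le> a") auto
  have eq: "(LEAST k. P k) = Min ?K"
    using min le by (intro Least_equality) auto
  show "P (LEAST k. P k)" using eq min by simp
  show "P k \<Longrightarrow> (LEAST k. P k) \<le> k" using eq le by simp
qed

section \<open>The prefix order\<close>

context group
begin

lemma inv_mult_cancel: "\<lbrakk>a \<in> carrier G; b \<in> carrier G\<rbrakk> \<Longrightarrow> inv a \<otimes> (a \<otimes> b) = b"
  by (simp flip: m_assoc)

lemma mult_inv_cancel: "\<lbrakk>a \<in> carrier G; b \<in> carrier G\<rbrakk> \<Longrightarrow> a \<otimes> (inv a \<otimes> b) = b"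
  by (simp flip: m_assoc)

lemma int_pow_mult_assoc:
  "\<lbrakk>d \<in> carrier G; b \<in> carrier G\<rbrakk> \<Longrightarrow> d [^] (i::int) \<otimes> (d [^] (j::int) \<otimes> b) = d [^] (i + j) \<otimes> b"
  by (simp add: int_pow_mult m_assoc)

lemma conjugate_closed [simp]:
  "\<lbrakk>a \<in> carrier G; b \<in> carrier G\<rbrakk> \<Longrightarrow> conjugate G a b \<in> carrier G"
  by (simp add: conjugate_def)

lemma conjugate_mult:
  "\<lbrakk>y \<in> carrier G; a \<in> carrier G; b \<in> carrier G\<rbrakk>
    \<Longrightarrow> conjugate G y (a \<otimes> b) = conjugate G (conjugate G y a) b"
  by (simp add: conjugate_def m_assoc inv_mult_group)

end

context garside_group
begin

text \<open>The relation of \<open>prefix_order G M\<close> outside its record, so that the order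
  laws can be proved before the record is known to be a partial order.\<close>

definition prec (infix "\<preceq>" 50) where "a \<preceq> b \<longleftrightarrow> inv a \<otimes> b \<in> M"

definition gmeet (infixl "\<and>\<and>" 70) where "a \<and>\<and> b = a \<sqinter>\<^bsub>prefix_order G M\<^esub> b"

lemma M_mult: "\<lbrakk>a \<in> M; b \<in> M\<rbrakk> \<Longrightarrow> a \<otimes> b \<in> M"
  by (rule m_closed)

lemma monoid_generated_byD:
  assumes "monoid_generated_by (G\<lparr>carrier := M\<rparr>) S" "a \<in> M"
  obtains xs where "set xs \<subseteq> S" "a = list_prod G xs"
proof -
  have "a \<in> carrier (G\<lparr>carrier := M\<rparr>)" using assms(2) by simp
  then have "a \<in> {list_prod (G\<lparr>carrier := M\<rparr>) xs | xs. set xs \<subseteq> S}"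
    using assms(1) unfolding monoid_generated_by_def by blast
  then show ?thesis using that by auto
qed

lemma list_prod_M [simp]: "set xs \<subseteq> M \<Longrightarrow> list_prod G xs \<in> M"
  by (induction xs) auto

lemma list_prod_append:
  "\<lbrakk>set xs \<subseteq> M; set ys \<subseteq> M\<rbrakk> \<Longrightarrow> list_prod G (xs @ ys) = list_prod G xs \<otimes> list_prod G ys"
  by (induction xs) (auto simp: m_assoc)

lemma list_prod_concat_replicate:
  "\<lbrakk>set xs \<subseteq> M; list_prod G xs = \<one>\<rbrakk> \<Longrightarrow> list_prod G (concat (replicate n xs)) = \<one>"
proof (induction n)
  case (Suc n)
  moreover have "set (concat (replicate n xs)) \<subseteq> M" using Suc.prems by (auto simp: set_replicate_conv_if)
  ultimately show ?case by (simp add: list_prod_append)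
qed simp

text \<open>Powers of a nontrivial product equal to \<open>\<one>\<close> would be arbitrarily long atomic decompositions
  of \<open>\<one>\<close>.\<close>

lemma M_conical:
  assumes "a \<in> M" "b \<in> M" "a \<otimes> b = \<one>"
  shows "a = \<one>"
proof -
  let ?N = "G\<lparr>carrier := M\<rparr>"
  have at: "monoid_generated_by ?N (atoms ?N)"
    and bd: "\<forall>a\<in>M. \<exists>N::nat. \<forall>xs. set xs \<subseteq> atoms ?N \<and> list_prod G xs = a \<longrightarrow> length xs \<le> N"
    using garside_monoid.atomic[OF monoid_M] by (simp_all add: atomic_monoid_def)
  have sub: "atoms ?N \<subseteq> M" using at by (simp add: monoid_generated_by_def)
  have gen: "\<exists>xs. set xs \<subseteq> atoms ?N \<and> a = list_prod G xs" if "a \<in> M" for a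
    using monoid_generated_byD[OF at that] by blast
  obtain xs where xs: "set xs \<subseteq> atoms ?N" "a = list_prod G xs" using gen assms(1) by blast
  obtain ys where ys: "set ys \<subseteq> atoms ?N" "b = list_prod G ys" using gen assms(2) by blast
  obtain N where N: "\<And>zs. set zs \<subseteq> atoms ?N \<Longrightarrow> list_prod G zs = \<one> \<Longrightarrow> length zs \<le> N"
    using bd one_closed by blast
  define zs where "zs = concat (replicate (Suc N) (xs @ ys))"
  have prod: "list_prod G (xs @ ys) = \<one>"
    using xs ys sub assms(3) by (subst list_prod_append) auto
  have "set zs \<subseteq> atoms ?N" using xs ys by (auto simp: zs_def set_replicate_conv_if)
  moreover have "list_prod G zs = \<one>"
    unfolding zs_def by (rule list_prod_concat_replicate) (use xs ys sub prod in auto)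
  ultimately have "length zs \<le> N" by (rule N)
  moreover have "length zs = Suc N * length (xs @ ys)"
    by (simp add: zs_def length_concat sum_list_replicate)
  ultimately have "xs = []" by (cases xs) auto
  with xs show ?thesis by simp
qed

lemma prec_M: "a \<in> M \<Longrightarrow> \<one> \<preceq> a"
  by (simp add: prec_def)

lemma one_prec_iff: "a \<in> carrier G \<Longrightarrow> \<one> \<preceq> a \<longleftrightarrow> a \<in> M"
  by (simp add: prec_def)

lemma prec_refl [simp]: "a \<in> carrier G \<Longrightarrow> a \<preceq> a"
  by (simp add: prec_def)

lemma prec_trans:
  assumes "a \<preceq> b" "b \<preceq> c" "a \<in> carrier G" "b \<in> carrier G" "c \<in> carrier G"
  shows "a \<preceq> c"
proof -
  have "inv a \<otimes> c = (inv a \<otimes> b) \<otimes> (inv b \<otimes> c)"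
    using assms by (simp add: m_assoc mult_inv_cancel)
  then show ?thesis using assms M_mult unfolding prec_def by simp
qed

text \<open>The quotients \<open>inv a \<otimes> b\<close> and \<open>inv b \<otimes> a\<close> lie
  in \<open>M\<close> and have product \<open>\<one>\<close>, so \<open>M_conical\<close> makes them
  trivial.\<close>

lemma prec_antisym:
  assumes "a \<preceq> b" "b \<preceq> a" "a \<in> carrier G" "b \<in> carrier G"
  shows "a = b"
proof -
  have "(inv a \<otimes> b) \<otimes> (inv b \<otimes> a) = \<one>"
    using assms by (simp add: m_assoc mult_inv_cancel)
  then have "inv a \<otimes> b = \<one>" using M_conical assms unfolding prec_def by blast
  then show ?thesis using assms mult_inv_cancel[of a b] by simp
qed

lemma prec_left_mult:
  "\<lbrakk>a \<in> carrier G; b \<in> carrier G; c \<in> carrier G\<rbrakk> \<Longrightarrow> c \<otimes> a \<preceq> c \<otimes> b \<longleftrightarrow> a \<preceq> b"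
  by (simp add: prec_def inv_mult_group m_assoc inv_mult_cancel)

lemma prec_mult_M: "\<lbrakk>a \<in> carrier G; b \<in> M\<rbrakk> \<Longrightarrow> a \<preceq> a \<otimes> b"
  by (simp add: prec_def inv_mult_cancel)

text \<open>Bridge between divisibility inside \<open>M\<close>, in which the Garside axioms are
  phrased, and the order on \<open>G\<close>.\<close>

lemma prec_factor:
  assumes "a \<in> M" "b \<in> M"
  shows "a divides\<^bsub>G\<lparr>carrier := M\<rparr>\<^esub> b \<longleftrightarrow> a \<preceq> b"
proof
  assume "a divides\<^bsub>G\<lparr>carrier := M\<rparr>\<^esub> b"
  then obtain c where "c \<in> M" "b = a \<otimes> c" unfolding factor_def by auto
  with assms show "a \<preceq> b" by (simp add: prec_mult_M)
next
  assume "a \<preceq> b"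
  then have "inv a \<otimes> b \<in> M" by (simp add: prec_def)
  moreover have "b = a \<otimes> (inv a \<otimes> b)" using assms by (simp add: mult_inv_cancel)
  ultimately have "\<exists>c\<in>M. b = a \<otimes> c" by (rule bexI[rotated])
  then show "a divides\<^bsub>G\<lparr>carrier := M\<rparr>\<^esub> b" by (simp only: factor_def) simp
qed

section \<open>Simple elements and powers of \<delta>\<close>

lemma delta_M [simp]: "\<delta> \<in> M"
  using garside_monoid.garside[OF monoid_M, unfolded garside_element_def, THEN conjunct1] by simp

lemma simples_eq: "simples G M \<delta> = {s \<in> M. s \<preceq> \<delta>}"
  by (simp add: simples_def prec_def prefix_order_def)

lemma simples_carrier [simp]: "s \<in> simples G M \<delta> \<Longrightarrow> s \<in> M"
  unfolding simples_eq by blast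

text \<open>The three properties of a Garside element, carried over to \<open>simples\<close>. The
  first, that prefixes and suffixes of \<delta> coincide, is what makes complements of simple
  elements simple.\<close>

lemma
  shows simples_right: "simples G M \<delta> = {s \<in> M. \<exists>c\<in>M. \<delta> = c \<otimes> s}"
    and finite_simples: "finite (simples G M \<delta>)"
    and simples_generate: "monoid_generated_by (G\<lparr>carrier := M\<rparr>) (simples G M \<delta>)"
proof -
  let ?N = "G\<lparr>carrier := M\<rparr>"
  have eq: "{s \<in> carrier ?N. s divides\<^bsub>?N\<^esub> \<delta>} = simples G M \<delta>"
    unfolding simples_eq by (rule Collect_cong) (auto simp: prec_factor)
  note g = garside_monoid.garside[OF monoid_M, unfolded garside_element_def eq]
  show "simples G M \<delta> = {s \<in> M. \<exists>c\<in>M. \<delta> = c \<otimes> s}"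
    by (rule trans[OF g[THEN conjunct2, THEN conjunct1]]) simp
  show "finite (simples G M \<delta>)"
    by (rule g[THEN conjunct2, THEN conjunct2, THEN conjunct1])
  show "monoid_generated_by ?N (simples G M \<delta>)"
    by (rule g[THEN conjunct2, THEN conjunct2, THEN conjunct2])
qed

text \<open>The cofactor \<open>inv s \<otimes> \<delta>\<close> is a suffix of \<delta>, hence
  simple by \<open>simples_right\<close>.\<close>

lemma simples_left_compl:
  assumes "s \<in> simples G M \<delta>"
  obtains t where "t \<in> simples G M \<delta>" "\<delta> = s \<otimes> t"
proof -
  have s: "s \<in> M" "inv s \<otimes> \<delta> \<in> M"
    using assms unfolding simples_eq prec_def by blast+
  then have eq: "\<delta> = s \<otimes> (inv s \<otimes> \<delta>)"
    by (simp add: mult_inv_cancel)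
  have "\<exists>c\<in>M. \<delta> = c \<otimes> (inv s \<otimes> \<delta>)" using eq s(1) by (rule bexI)
  then have "inv s \<otimes> \<delta> \<in> simples G M \<delta>"
    using s(2) by (simp only: simples_right mem_Collect_eq simp_thms)
  then show ?thesis using eq by (rule that)
qed

lemma simples_right_compl:
  assumes "s \<in> simples G M \<delta>"
  obtains t where "t \<in> simples G M \<delta>" "\<delta> = t \<otimes> s"
proof -
  obtain c where c: "c \<in> M" "\<delta> = c \<otimes> s" using assms unfolding simples_right by blast
  then have "c \<preceq> \<delta>"
    using simples_carrier[OF assms] by (simp add: prec_mult_M)
  then have "c \<in> simples G M \<delta>" using c(1) unfolding simples_eq by blast
  with c show ?thesis using that by blast
qed

lemma M_simples_induct [consumes 1, case_names one mult]:
  assumes "m \<in> M" and "P \<one>"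
    and step: "\<And>s b. \<lbrakk>s \<in> simples G M \<delta>; b \<in> M; P b\<rbrakk> \<Longrightarrow> P (s \<otimes> b)"
  shows "P m"
proof -
  obtain xs where xs: "set xs \<subseteq> simples G M \<delta>" "m = list_prod G xs"
    using monoid_generated_byD[OF simples_generate assms(1)] .
  have "P (list_prod G xs)" using xs(1)
  proof (induction xs)
    case Nil
    then show ?case using assms(2) by simp
  next
    case (Cons s xs)
    then have "list_prod G xs \<in> M" by (intro list_prod_M) auto
    with Cons show ?case using step by simp
  qed
  with xs show ?thesis by simp
qed

text \<open>For simple \<open>s\<close> take complements twice: \<delta> = st and \<delta> = tt'
  give s\<delta> = stt' = \<delta>t', so the conjugate of \<open>s\<close> by \<delta> is t'.
  Complements on the other side treat the inverse conjugation, and induction over simple factors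
  covers all of \<open>M\<close>.\<close>

lemma tau_M:
  assumes "m \<in> M"
  shows "inv \<delta> \<otimes> m \<otimes> \<delta> \<in> M" "\<delta> \<otimes> m \<otimes> inv \<delta> \<in> M"
  using assms
proof (induction m rule: M_simples_induct)
  case one
  show "inv \<delta> \<otimes> \<one> \<otimes> \<delta> \<in> M" "\<delta> \<otimes> \<one> \<otimes> inv \<delta> \<in> M" by simp_all
next
  case (mult s b)
  obtain t where t: "t \<in> simples G M \<delta>" "\<delta> = s \<otimes> t" using simples_left_compl mult(1) .
  obtain t' where t': "t' \<in> simples G M \<delta>" "\<delta> = t \<otimes> t'" using simples_left_compl t(1) .
  have "inv \<delta> \<otimes> (s \<otimes> \<delta>) = inv \<delta> \<otimes> (s \<otimes> (t \<otimes> t'))" by (simp only: flip: t'(2))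
  also have "\<dots> = inv \<delta> \<otimes> (s \<otimes> t \<otimes> t')"
    using t'(1) t(1) mult(1) by (simp add: m_assoc)
  also have "\<dots> = inv \<delta> \<otimes> (\<delta> \<otimes> t')" by (simp only: flip: t(2))
  finally have s: "inv \<delta> \<otimes> (s \<otimes> \<delta>) \<in> M" using t'(1) by (simp add: inv_mult_cancel)
  obtain p where p: "p \<in> simples G M \<delta>" "\<delta> = p \<otimes> s" using simples_right_compl mult(1) .
  obtain q where q: "q \<in> simples G M \<delta>" "\<delta> = q \<otimes> p" using simples_right_compl p(1) .
  have "\<delta> \<otimes> s \<otimes> inv \<delta> = q \<otimes> p \<otimes> s \<otimes> inv \<delta>" by (simp only: flip: q(2))
  also have "\<dots> = q \<otimes> (p \<otimes> s) \<otimes> inv \<delta>" using p(1) q(1) mult(1) by (simp add: m_assoc)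
  also have "\<dots> = q" using p(2)[symmetric] q(1) by (simp add: m_assoc)
  finally have s': "\<delta> \<otimes> s \<otimes> inv \<delta> \<in> M" using q(1) by simp
  have "inv \<delta> \<otimes> (s \<otimes> b) \<otimes> \<delta> = inv \<delta> \<otimes> (s \<otimes> \<delta>) \<otimes> (inv \<delta> \<otimes> b \<otimes> \<delta>)"
    using mult(1,2) by (simp add: m_assoc mult_inv_cancel)
  then show "inv \<delta> \<otimes> (s \<otimes> b) \<otimes> \<delta> \<in> M" using s mult(3) M_mult by simp
  have "\<delta> \<otimes> (s \<otimes> b) \<otimes> inv \<delta> = \<delta> \<otimes> s \<otimes> inv \<delta> \<otimes> (\<delta> \<otimes> b \<otimes> inv \<delta>)"
    using mult(1,2) by (simp add: m_assoc inv_mult_cancel)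
  then show "\<delta> \<otimes> (s \<otimes> b) \<otimes> inv \<delta> \<in> M" using s' mult(4) M_mult by simp
qed

lemma delta_carrier [simp]: "\<delta> \<in> carrier G"
  by simp

lemma tau_int_pow_M:
  assumes "m \<in> M"
  shows "\<delta> [^] (- j) \<otimes> m \<otimes> \<delta> [^] (j::int) \<in> M"
proof (induction j rule: int_induct[where k = 0])
  case base
  show ?case using assms by simp
next
  case (step1 j)
  have "- (j + 1) = - 1 + - j" by simp
  then have "\<delta> [^] (- (j + 1)) = inv \<delta> \<otimes> \<delta> [^] (- j)"
    by (simp only: int_pow_mult[OF delta_carrier]) (simp add: int_pow_neg)
  moreover have "\<delta> [^] (j + 1) = \<delta> [^] j \<otimes> \<delta>" by (simp add: int_pow_mult)
  ultimately have "\<delta> [^] (- (j + 1)) \<otimes> m \<otimes> \<delta> [^] (j + 1)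
      = inv \<delta> \<otimes> (\<delta> [^] (- j) \<otimes> m \<otimes> \<delta> [^] j) \<otimes> \<delta>"
    using assms by (simp add: m_assoc)
  then show ?case using tau_M(1)[OF step1(2)] by simp
next
  case (step2 j)
  have "- (j - 1) = 1 + - j" by simp
  then have "\<delta> [^] (- (j - 1)) = \<delta> \<otimes> \<delta> [^] (- j)"
    by (simp only: int_pow_mult[OF delta_carrier]) simp
  moreover have "\<delta> [^] (j - 1) = \<delta> [^] j \<otimes> inv \<delta>"
    using int_pow_mult[of \<delta> "j" "-1"] by (simp add: int_pow_neg)
  ultimately have "\<delta> [^] (- (j - 1)) \<otimes> m \<otimes> \<delta> [^] (j - 1)
      = \<delta> \<otimes> (\<delta> [^] (- j) \<otimes> m \<otimes> \<delta> [^] j) \<otimes> inv \<delta>"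
    using assms by (simp add: m_assoc)
  then show ?case using tau_M(2)[OF step2(2)] by simp
qed

text \<open>Right multiplication need not respect a left-invariant order. For powers of \<delta> it
  does, because it changes the quotient \<open>inv a \<otimes> b\<close> only by conjugation with
  such a power, which preserves \<open>M\<close>.\<close>

lemma prec_delta_pow:
  assumes "a \<in> carrier G" "b \<in> carrier G"
  shows "a \<otimes> \<delta> [^] (j::int) \<preceq> b \<otimes> \<delta> [^] j \<longleftrightarrow> a \<preceq> b"
proof -
  have *: "a \<otimes> \<delta> [^] j \<preceq> b \<otimes> \<delta> [^] j"
    if "a \<preceq> b" "a \<in> carrier G" "b \<in> carrier G" for a b and j :: int
    using tau_int_pow_M[of "inv a \<otimes> b" j] that
    by (simp add: prec_def inv_mult_group int_pow_neg m_assoc)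
  have "a \<preceq> b" if "a \<otimes> \<delta> [^] j \<preceq> b \<otimes> \<delta> [^] j"
    using *[OF that, of "- j"] assms by (simp add: m_assoc flip: int_pow_mult)
  with * assms show ?thesis by blast
qed

lemma delta_pow_M: "j \<ge> 0 \<Longrightarrow> \<delta> [^] (j::int) \<in> M"
proof (induction j rule: int_ge_induct)
  case (step i)
  then show ?case by (simp add: int_pow_mult)
qed simp

lemma delta_pow_prec: "i \<le> j \<Longrightarrow> \<delta> [^] (i::int) \<preceq> \<delta> [^] (j::int)"
  using delta_pow_M[of "j - i"] by (simp add: prec_def flip: int_pow_neg int_pow_mult)

text \<open>Each simple factor costs one more \<delta>: the product
  \<open>\<delta> \<otimes> inv s\<close> is a complement of \<open>s\<close>, and the quotient
  found so far passes \<delta> by a conjugation that preserves \<open>M\<close>.\<close>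

lemma M_delta_pow_right:
  assumes "b \<in> M"
  obtains n :: int where "\<delta> [^] n \<otimes> inv b \<in> M"
  using assms
proof (induction b arbitrary: thesis rule: M_simples_induct)
  case one
  show ?case by (rule one[of 0]) simp
next
  case (mult s b)
  then obtain n :: int where n: "\<delta> [^] n \<otimes> inv b \<in> M" by blast
  obtain t where t: "t \<in> simples G M \<delta>" "\<delta> = t \<otimes> s" using simples_right_compl mult(1) .
  have ts: "\<delta> \<otimes> inv s = t" using t mult(1) by (metis inv_solve_right mem_carrier delta_carrier simples_carrier)
  have "\<delta> [^] (n + 1) \<otimes> inv (s \<otimes> b) = \<delta> \<otimes> (\<delta> [^] n \<otimes> inv b) \<otimes> inv s"
    using mult(1,2) int_pow_mult[of \<delta> 1 n] by (simp add: inv_mult_group m_assoc add.commute)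
  also have "\<dots> = (\<delta> \<otimes> (\<delta> [^] n \<otimes> inv b) \<otimes> inv \<delta>) \<otimes> (\<delta> \<otimes> inv s)"
    using mult(1,2) by (simp add: m_assoc inv_mult_cancel)
  finally have "\<delta> [^] (n + 1) \<otimes> inv (s \<otimes> b) \<in> M"
    using tau_M(2)[OF n] ts t(1) M_mult by simp
  then show ?case by (rule mult.prems)
qed

text \<open>For a fraction \<open>a \<otimes> inv b\<close>, a power of \<delta> that absorbs
  \<open>inv b\<close> can be moved past \<open>a\<close> by conjugation, which puts the whole
  product in \<open>M\<close>.\<close>

lemma delta_pow_prec_exists:
  assumes "g \<in> carrier G"
  obtains n :: int where "\<delta> [^] n \<preceq> g"
proof -
  obtain a b where ab: "a \<in> M" "b \<in> M" "g = a \<otimes> inv b" using assms fractions by blast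
  obtain n :: int where n: "\<delta> [^] n \<otimes> inv b \<in> M" using M_delta_pow_right ab(2) .
  have "(\<delta> [^] n \<otimes> a \<otimes> \<delta> [^] (- n)) \<otimes> (\<delta> [^] n \<otimes> inv b) = \<delta> [^] n \<otimes> g"
    using ab by (simp add: m_assoc int_pow_mult_assoc)
  then have "\<delta> [^] n \<otimes> g \<in> M" using M_mult[OF tau_int_pow_M[OF ab(1), of "- n"] n] by simp
  then have "\<delta> [^] (- n) \<preceq> g" using assms by (simp add: prec_def int_pow_neg)
  then show ?thesis by (rule that)
qed

text \<open>A lower bound of \<open>inv g\<close> yields an upper bound of \<open>g\<close>:
  inversion moves the power of \<delta> to the other side, and conjugation by it corrects the order
  of the factors.\<close>

lemma prec_delta_pow_exists:
  assumes "g \<in> carrier G"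
  obtains n :: int where "g \<preceq> \<delta> [^] n"
proof -
  obtain n :: int where n: "\<delta> [^] n \<preceq> inv g" using delta_pow_prec_exists assms by blast
  have "inv g \<otimes> \<delta> [^] (- n) = \<delta> [^] n \<otimes> (\<delta> [^] (- n) \<otimes> inv g) \<otimes> \<delta> [^] (- n)"
    using assms by (simp add: int_pow_mult_assoc)
  then have "inv g \<otimes> \<delta> [^] (- n) \<in> M"
    using tau_int_pow_M[of "\<delta> [^] (- n) \<otimes> inv g" "- n"] n by (simp add: prec_def int_pow_neg)
  then have "g \<preceq> \<delta> [^] (- n)" by (simp add: prec_def)
  then show ?thesis by (rule that)
qed

section \<open>Meets in the group\<close>

lemma prefix_order_simps [simp]:
  "carrier (prefix_order G M) = carrier G"
  "(a .=\<^bsub>prefix_order G M\<^esub> b) \<longleftrightarrow> a = b"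
  "(a \<sqsubseteq>\<^bsub>prefix_order G M\<^esub> b) \<longleftrightarrow> a \<preceq> b"
  by (simp_all add: prefix_order_def prec_def)

text \<open>Left translation by \<open>inv e\<close> moves \<open>a\<close> and \<open>b\<close>
  into \<open>M\<close>, where gcds exist. Translated back, the gcd is so far greatest only among
  the common lower bounds above \<open>e\<close>.\<close>

lemma gcd_above:
  assumes e: "e \<in> carrier G" "e \<preceq> a" "e \<preceq> b" and ab: "a \<in> carrier G" "b \<in> carrier G"
  obtains d where "d \<in> carrier G" "e \<preceq> d" "d \<preceq> a" "d \<preceq> b"
    "\<And>c. \<lbrakk>c \<in> carrier G; e \<preceq> c; c \<preceq> a; c \<preceq> b\<rbrakk> \<Longrightarrow> c \<preceq> d"
proof -
  have ea: "inv e \<otimes> a \<in> M" "inv e \<otimes> b \<in> M"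
    using e by (simp_all add: prec_def)
  then obtain d where d: "d \<in> M" "d gcdof\<^bsub>G\<lparr>carrier := M\<rparr>\<^esub> (inv e \<otimes> a) (inv e \<otimes> b)"
    using garside_monoid.gcd_exists[OF monoid_M] by auto
  then have d1: "d \<preceq> inv e \<otimes> a" "d \<preceq> inv e \<otimes> b"
    and d2: "\<And>c. \<lbrakk>c \<in> M; c \<preceq> inv e \<otimes> a; c \<preceq> inv e \<otimes> b\<rbrakk> \<Longrightarrow> c \<preceq> d"
    using ea by (auto simp: isgcd_def prec_factor)
  have shift: "c \<preceq> inv e \<otimes> a' \<longleftrightarrow> e \<otimes> c \<preceq> a'" if "c \<in> carrier G" "a' \<in> carrier G" for c a'
    using prec_left_mult[of c "inv e \<otimes> a'" e] that e by (simp add: mult_inv_cancel)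
  show ?thesis
  proof (rule that[of "e \<otimes> d"])
    show "e \<otimes> d \<in> carrier G" using d e by simp
    show "e \<preceq> e \<otimes> d" using d e by (simp add: prec_mult_M)
    show "e \<otimes> d \<preceq> a" "e \<otimes> d \<preceq> b" using d d1 ab shift by auto
    fix c assume c: "c \<in> carrier G" "e \<preceq> c" "c \<preceq> a" "c \<preceq> b"
    then have "inv e \<otimes> c \<preceq> d"
      using e ab by (intro d2) (simp_all add: shift mult_inv_cancel, simp add: prec_def)
    then show "c \<preceq> e \<otimes> d"
      using prec_left_mult[of "inv e \<otimes> c" d e] c d e by (simp add: mult_inv_cancel)
  qed
qed

text \<open>Every common lower bound \<open>c\<close> lies above some power of \<delta>, so it is
  bounded by the gcd \<open>d'\<close> relative to a lower base. As \<delta>\<open>[^] n\<close> is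
  itself a common lower bound, \<open>d'\<close> lies above it and is therefore bounded by the gcd
  \<open>d\<close> relative to the original base.\<close>

lemma gcd_carrier:
  assumes ab: "a \<in> carrier G" "b \<in> carrier G"
  obtains d where "d \<in> carrier G" "d \<preceq> a" "d \<preceq> b"
    "\<And>c. \<lbrakk>c \<in> carrier G; c \<preceq> a; c \<preceq> b\<rbrakk> \<Longrightarrow> c \<preceq> d"
proof -
  obtain n1 :: int where n1: "\<delta> [^] n1 \<preceq> a" using delta_pow_prec_exists ab(1) .
  obtain n2 :: int where n2: "\<delta> [^] n2 \<preceq> b" using delta_pow_prec_exists ab(2) .
  have below: "\<delta> [^] n \<preceq> a" if "n \<le> n1" for n
    using prec_trans[OF delta_pow_prec[OF that] n1] ab by simp
  have below': "\<delta> [^] n \<preceq> b" if "n \<le> n2" for n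
    using prec_trans[OF delta_pow_prec[OF that] n2] ab by simp
  define n where "n = min n1 n2"
  obtain d where d: "d \<in> carrier G" "\<delta> [^] n \<preceq> d" "d \<preceq> a" "d \<preceq> b"
    and max: "\<And>c. \<lbrakk>c \<in> carrier G; \<delta> [^] n \<preceq> c; c \<preceq> a; c \<preceq> b\<rbrakk> \<Longrightarrow> c \<preceq> d"
    using gcd_above[of "\<delta> [^] n" a b] below below' ab by (auto simp: n_def)
  show ?thesis
  proof (rule that[OF d(1,3,4)])
    fix c assume c: "c \<in> carrier G" "c \<preceq> a" "c \<preceq> b"
    obtain n3 :: int where n3: "\<delta> [^] n3 \<preceq> c" using delta_pow_prec_exists c(1) .
    define m where "m = min n n3"
    obtain d' where d': "d' \<in> carrier G" "\<delta> [^] m \<preceq> d'" "d' \<preceq> a" "d' \<preceq> b"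
      and max': "\<And>c. \<lbrakk>c \<in> carrier G; \<delta> [^] m \<preceq> c; c \<preceq> a; c \<preceq> b\<rbrakk> \<Longrightarrow> c \<preceq> d'"
      using gcd_above[of "\<delta> [^] m" a b] below below' ab by (auto simp: m_def n_def)
    have "\<delta> [^] m \<preceq> c"
      using prec_trans[OF delta_pow_prec n3] c by (simp add: m_def)
    with c have "c \<preceq> d'" by (intro max')
    moreover have "\<delta> [^] m \<preceq> \<delta> [^] n" by (simp add: m_def delta_pow_prec)
    then have "\<delta> [^] n \<preceq> d'"
      using below below' by (intro max') (simp_all add: n_def)
    then have "d' \<preceq> d" using d' by (intro max)
    ultimately show "c \<preceq> d" using prec_trans c(1) d'(1) d(1) by blast
  qed
qed

sublocale po: lower_semilattice "prefix_order G M"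
proof -
  interpret partial_order "prefix_order G M"
    by unfold_locales (simp_all add: fun_eq_iff, (erule (1) prec_antisym prec_trans; assumption)+)
  show "lower_semilattice (prefix_order G M)"
  proof unfold_locales
    fix a b assume "a \<in> carrier (prefix_order G M)" "b \<in> carrier (prefix_order G M)"
    then obtain d where "d \<in> carrier G" "d \<preceq> a" "d \<preceq> b"
      and max: "\<And>c. \<lbrakk>c \<in> carrier G; c \<preceq> a; c \<preceq> b\<rbrakk> \<Longrightarrow> c \<preceq> d"
      and "a \<in> carrier G" "b \<in> carrier G"
      using gcd_carrier by (metis prefix_order_simps(1))
    then show "\<exists>s. greatest (prefix_order G M) s (Lower (prefix_order G M) {a, b})"
      by (intro exI[of _ d]) (auto simp: greatest_def Lower_def intro!: max)
  qed
qed

lemma gmeet_closed [simp]: "\<lbrakk>a \<in> carrier G; b \<in> carrier G\<rbrakk> \<Longrightarrow> a \<and>\<and> b \<in> carrier G"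
  using po.meet_closed by (simp add: gmeet_def)

lemma gmeet_lower:
  assumes "a \<in> carrier G" "b \<in> carrier G"
  shows "a \<and>\<and> b \<preceq> a" "a \<and>\<and> b \<preceq> b"
  using assms po.meet_left[of a b] po.meet_right[of a b] by (simp_all add: gmeet_def)

lemma prec_gmeet_iff:
  assumes "a \<in> carrier G" "b \<in> carrier G" "c \<in> carrier G"
  shows "c \<preceq> a \<and>\<and> b \<longleftrightarrow> c \<preceq> a \<and> c \<preceq> b"
proof
  show "c \<preceq> a \<and> c \<preceq> b" if "c \<preceq> a \<and>\<and> b"
    using prec_trans[OF that] gmeet_lower[of a b] assms by simp
  show "c \<preceq> a \<and>\<and> b" if "c \<preceq> a \<and> c \<preceq> b"
    using po.meet_le[of c a b] that assms by (simp add: gmeet_def)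
qed

text \<open>An element is determined by its lower bounds. Identities between meets are checked below
  by comparing these.\<close>

lemma gmeet_eqI:
  assumes "a \<in> carrier G" "b \<in> carrier G" "d \<in> carrier G"
    and "\<And>c. c \<in> carrier G \<Longrightarrow> c \<preceq> d \<longleftrightarrow> c \<preceq> a \<and> c \<preceq> b"
  shows "a \<and>\<and> b = d"
proof (rule prec_antisym)
  show "a \<and>\<and> b \<preceq> d"
    using assms(1,2) prec_gmeet_iff[of a b "a \<and>\<and> b"] assms(4)[of "a \<and>\<and> b"] by simp
  show "d \<preceq> a \<and>\<and> b"
    using assms(1-3) prec_gmeet_iff[of a b d] assms(4)[of d] by simp
qed (use assms in auto)

lemma gmeet_absorb: "\<lbrakk>a \<preceq> b; a \<in> carrier G; b \<in> carrier G\<rbrakk> \<Longrightarrow> a \<and>\<and> b = a"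
  by (rule gmeet_eqI) (use prec_trans[of _ a b] in auto)

lemma gmeet_M: "\<lbrakk>a \<in> M; b \<in> M\<rbrakk> \<Longrightarrow> a \<and>\<and> b \<in> M"
  using prec_gmeet_iff[of a b \<one>] by (simp add: one_prec_iff)

lemma gmeet_left_mult:
  assumes "a \<in> carrier G" "b \<in> carrier G" "c \<in> carrier G"
  shows "(c \<otimes> a) \<and>\<and> (c \<otimes> b) = c \<otimes> (a \<and>\<and> b)"
proof (rule gmeet_eqI)
  fix p assume p: "p \<in> carrier G"
  show "p \<preceq> c \<otimes> (a \<and>\<and> b) \<longleftrightarrow> p \<preceq> c \<otimes> a \<and> p \<preceq> c \<otimes> b"
    using assms p prec_left_mult[of "inv c \<otimes> p" _ c] by (simp add: mult_inv_cancel prec_gmeet_iff)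
qed (use assms in auto)

text \<open>Right multiplication by a power of \<delta> is an order automorphism, by
  \<open>prec_delta_pow\<close>.\<close>

lemma gmeet_delta_pow:
  assumes "a \<in> carrier G" "b \<in> carrier G"
  shows "(a \<otimes> \<delta> [^] (j::int)) \<and>\<and> (b \<otimes> \<delta> [^] j) = (a \<and>\<and> b) \<otimes> \<delta> [^] j"
proof (rule gmeet_eqI)
  fix p assume p: "p \<in> carrier G"
  show "p \<preceq> (a \<and>\<and> b) \<otimes> \<delta> [^] j \<longleftrightarrow> p \<preceq> a \<otimes> \<delta> [^] j \<and> p \<preceq> b \<otimes> \<delta> [^] j"
    using assms p prec_delta_pow[of "p \<otimes> \<delta> [^] (- j)" _ j]
    by (simp add: m_assoc prec_gmeet_iff flip: int_pow_mult)
qed (use assms in auto)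


section \<open>Normal forms\<close>

text \<open>Greedy decomposition: split off \<open>\<delta> \<and>\<and> z\<close> and continue with
  the rest. The length is prescribed instead of minimal, so the list may end in copies of
  \<open>\<one>\<close>.\<close>

lemma normal_form_length_exists:
  assumes "z \<in> M" "z \<preceq> \<delta> [^] int r"
  shows "\<exists>As. length As = r \<and> set As \<subseteq> simples G M \<delta> \<and> list_prod G As = z \<and>
    (\<forall>i. Suc i < r \<longrightarrow> (inv (As ! i) \<otimes> \<delta>) \<and>\<and> (As ! Suc i) = \<one>) \<and> (r > 0 \<longrightarrow> hd As = \<delta> \<and>\<and> z)"
  using assms
proof (induction r arbitrary: z)
  case 0
  then have "z = \<one>" by (intro prec_antisym) (simp_all add: prec_M)
  then show ?case by simp
next
  case (Suc r)
  define A where "A = \<delta> \<and>\<and> z"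
  define z' where "z' = inv A \<otimes> z"
  have [simp]: "z \<in> carrier G" using Suc.prems by simp
  have A: "A \<in> M" "A \<preceq> \<delta>" "A \<preceq> z"
    using Suc.prems gmeet_M[of \<delta> z] gmeet_lower[of \<delta> z] by (simp_all add: A_def)
  have z': "z' \<in> M" using A(3) by (simp add: z'_def prec_def)
  have zA: "A \<otimes> z' = z" using A(1) by (simp add: z'_def mult_inv_cancel)
  \<comment> \<open>Since \<open>z\<close> lies below both terms of this meet, it lies below the
    right-hand side. Cancelling \<open>A\<close> bounds the remainder by the next lower power of
    \<delta>.\<close>
  have "\<delta> [^] (1 + int r) \<and>\<and> (z \<otimes> \<delta> [^] int r) = A \<otimes> \<delta> [^] int r"
    using gmeet_delta_pow[of \<delta> z "int r"] int_pow_mult[of \<delta> 1 "int r"] by (simp add: A_def)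
  moreover have "z \<preceq> z \<otimes> \<delta> [^] int r" by (simp add: prec_mult_M delta_pow_M)
  ultimately have "z \<preceq> A \<otimes> \<delta> [^] int r"
    using Suc.prems prec_gmeet_iff[of "\<delta> [^] (1 + int r)" "z \<otimes> \<delta> [^] int r" z] by simp
  then have "z' \<preceq> \<delta> [^] int r"
    using prec_left_mult[of z' "\<delta> [^] int r" A] zA z' A(1) by simp
  with Suc.IH[OF z'] obtain As where As: "length As = r" "set As \<subseteq> simples G M \<delta>" "list_prod G As = z'"
    "\<forall>i. Suc i < r \<longrightarrow> (inv (As ! i) \<otimes> \<delta>) \<and>\<and> (As ! Suc i) = \<one>" "r > 0 \<longrightarrow> hd As = \<delta> \<and>\<and> z'"
    by blast
  have "(inv A \<otimes> \<delta>) \<and>\<and> z' = inv A \<otimes> A"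
    using gmeet_left_mult[of \<delta> z "inv A"] A(1) by (simp add: z'_def A_def)
  then have one: "(inv A \<otimes> \<delta>) \<and>\<and> z' = \<one>" using A(1) by simp
  \<comment> \<open>The next factor is \<open>\<delta> \<and>\<and> z'\<close> and not
    \<open>z'\<close>. The extra \<delta> changes nothing, as
    \<open>inv A \<otimes> \<delta>\<close> is simple and so already below \<delta>.\<close>
  have "(inv A \<otimes> \<delta>) \<and>\<and> (\<delta> \<and>\<and> z') = \<one>"
  proof (rule gmeet_eqI)
    fix c assume c: "c \<in> carrier G"
    have "inv A \<otimes> \<delta> \<in> simples G M \<delta>"
    proof -
      have "A \<in> simples G M \<delta>" using A unfolding simples_eq by blast
      then obtain t where "t \<in> simples G M \<delta>" "\<delta> = A \<otimes> t" using simples_left_compl by blast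
      then show ?thesis using A(1) inv_mult_cancel[of A t] by simp
    qed
    then have "inv A \<otimes> \<delta> \<preceq> \<delta>" unfolding simples_eq by blast
    then have "c \<preceq> \<delta>" if "c \<preceq> inv A \<otimes> \<delta>"
      using prec_trans[OF that] c A(1) by simp
    then show "c \<preceq> \<one> \<longleftrightarrow> c \<preceq> inv A \<otimes> \<delta> \<and> c \<preceq> \<delta> \<and>\<and> z'"
      using prec_gmeet_iff[of "inv A \<otimes> \<delta>" z' c] prec_gmeet_iff[of \<delta> z' c] c A(1) z' one by auto
  qed (use A(1) z' in auto)
  then have "(inv ((A # As) ! i) \<otimes> \<delta>) \<and>\<and> ((A # As) ! Suc i) = \<one>" if "Suc i < Suc r" for i
    using that As(1,4,5) by (cases i; cases As) auto
  moreover have "set (A # As) \<subseteq> simples G M \<delta>" using A As(2) unfolding simples_eq by auto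
  ultimately show ?case using As(1,3) zA A_def
    by (intro exI[of _ "A # As"]) (simp del: nth_Cons_Suc)
qed

text \<open>The condition on neighbours determines the head globally. With \<delta> = At and
  \<open>P\<close> the product of the tail, whose head is \<open>B\<close> by induction, t \<and> P
  equals t \<and> B = 1 because \<open>t\<close> is below \<delta>. Multiplying by \<open>A\<close>
  gives \<delta> \<and> AP = A.\<close>

lemma normal_list_hd:
  assumes "set (A # As) \<subseteq> simples G M \<delta>"
    and "\<And>i. Suc i < length (A # As) \<Longrightarrow> (inv ((A # As) ! i) \<otimes> \<delta>) \<and>\<and> ((A # As) ! Suc i) = \<one>"
  shows "\<delta> \<and>\<and> list_prod G (A # As) = A"
  using assms
proof (induction As arbitrary: A)
  case Nil
  then have "A \<in> M" "A \<preceq> \<delta>" unfolding simples_eq by auto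
  then have "\<delta> \<and>\<and> A = A" by (intro gmeet_eqI) (use prec_trans[of _ A \<delta>] in auto)
  then show ?case using \<open>A \<in> M\<close> by simp
next
  case (Cons B As)
  define P where "P = list_prod G (B # As)"
  have P: "P \<in> M" using Cons.prems(1) unfolding P_def by (intro list_prod_M) auto
  have A: "A \<in> simples G M \<delta>" and AM: "A \<in> M" using Cons.prems(1) by auto
  have B: "B \<in> M" using Cons.prems(1) by auto
  have "\<delta> \<and>\<and> P = B"
    unfolding P_def
  proof (rule Cons.IH)
    show "set (B # As) \<subseteq> simples G M \<delta>" using Cons.prems(1) by auto
    show "(inv ((B # As) ! i) \<otimes> \<delta>) \<and>\<and> ((B # As) ! Suc i) = \<one>" if "Suc i < length (B # As)" for i
      using Cons.prems(2)[of "Suc i"] that by simp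
  qed
  then have *: "c \<preceq> B \<longleftrightarrow> c \<preceq> \<delta> \<and> c \<preceq> P" if "c \<in> carrier G" for c
    using prec_gmeet_iff[of \<delta> P c] that P by simp
  obtain t where t: "t \<in> simples G M \<delta>" "\<delta> = A \<otimes> t" using simples_left_compl A .
  have "inv A \<otimes> (A \<otimes> t) = t" using AM t(1) by (simp add: inv_mult_cancel)
  then have tA: "inv A \<otimes> \<delta> = t" by (simp only: flip: t(2))
  have "t \<preceq> \<delta>" using t(1) unfolding simples_eq by blast
  then have **: "c \<preceq> \<delta>" if "c \<preceq> t" "c \<in> carrier G" for c
    using prec_trans[of c t \<delta>] that t(1) by simp
  have "t \<and>\<and> B = \<one>" using Cons.prems(2)[of 0] tA by simp
  then have "c \<preceq> \<one> \<longleftrightarrow> c \<preceq> t \<and> c \<preceq> P" if "c \<in> carrier G" for c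
    using prec_gmeet_iff[of t B c] * ** that t(1) B by auto
  then have "t \<and>\<and> P = \<one>"
    using P t(1) by (intro gmeet_eqI) auto
  then have "(A \<otimes> t) \<and>\<and> (A \<otimes> P) = A"
    using gmeet_left_mult[of t P A] t(1) P AM by simp
  then show ?case using t(2)[symmetric] by (simp add: P_def)
qed

text \<open>The product determines the head, which is cancelled before continuing with the tails.
  Equal lengths are required because appending \<open>\<one>\<close> changes neither the product nor
  normality.\<close>

lemma normal_list_unique:
  assumes "length As = length Bs" "list_prod G As = list_prod G Bs"
    and "set As \<subseteq> simples G M \<delta>" "set Bs \<subseteq> simples G M \<delta>"
    and "\<And>i. Suc i < length As \<Longrightarrow> (inv (As ! i) \<otimes> \<delta>) \<and>\<and> (As ! Suc i) = \<one>"
    and "\<And>i. Suc i < length Bs \<Longrightarrow> (inv (Bs ! i) \<otimes> \<delta>) \<and>\<and> (Bs ! Suc i) = \<one>"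
  shows "As = Bs"
  using assms
proof (induction As Bs rule: list_induct2)
  case (Cons A As B Bs)
  have "A = B"
    using normal_list_hd[of A As, OF Cons.prems(2,4)] normal_list_hd[of B Bs, OF Cons.prems(3,5)]
      Cons.prems(1) by simp
  moreover have "list_prod G As \<in> M" "list_prod G Bs \<in> M" "A \<in> M"
    using Cons.prems(2,3) by (auto intro!: list_prod_M)
  ultimately have "list_prod G As = list_prod G Bs" using Cons.prems(1) by simp
  then have "As = Bs"
  proof (rule Cons.IH)
    show "(inv (As ! i) \<otimes> \<delta>) \<and>\<and> (As ! Suc i) = \<one>" if "Suc i < length As" for i
      using Cons.prems(4)[of "Suc i"] that by simp
    show "(inv (Bs ! i) \<otimes> \<delta>) \<and>\<and> (Bs ! Suc i) = \<one>" if "Suc i < length Bs" for i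
      using Cons.prems(5)[of "Suc i"] that by simp
  qed (use Cons.prems in auto)
  with \<open>A = B\<close> show ?case by simp
qed simp

text \<open>Every element of the interval is a product of \<open>nat m\<close> simple elements, of
  which there are finitely many. For negative \<open>m\<close> the exponent is raised to
  \<open>0\<close>, which can only enlarge the interval.\<close>

lemma finite_interval: "finite {u \<in> M. u \<preceq> \<delta> [^] (m::int)}"
proof -
  have "{u \<in> M. u \<preceq> \<delta> [^] m} \<subseteq> list_prod G ` {As. set As \<subseteq> simples G M \<delta> \<and> length As = nat m}"
  proof
    fix u assume u: "u \<in> {u \<in> M. u \<preceq> \<delta> [^] m}"
    then have "u \<preceq> \<delta> [^] int (nat m)"
      using prec_trans[OF _ delta_pow_prec[of m "int (nat m)"], of u] by simp
    then show "u \<in> list_prod G ` {As. set As \<subseteq> simples G M \<delta> \<and> length As = nat m}"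
      using normal_form_length_exists[of u "nat m"] u by (auto simp: image_iff)
  qed
  then show ?thesis
    by (rule finite_subset) (intro finite_imageI finite_lists_length_eq finite_simples)
qed

section \<open>Infimum and supremum\<close>

lemma delta_pow_prec_iff:
  assumes "\<delta> \<noteq> \<one>"
  shows "\<delta> [^] (i::int) \<preceq> \<delta> [^] (j::int) \<longleftrightarrow> i \<le> j"
proof
  assume le: "\<delta> [^] i \<preceq> \<delta> [^] j"
  show "i \<le> j"
  proof (rule ccontr)
    assume "\<not> i \<le> j"
    then have "\<delta> [^] (j + 1) \<preceq> \<delta> [^] j"
      using prec_trans[OF delta_pow_prec le, of "j + 1"] by simp
    then have "\<delta> \<preceq> \<one>"
      using prec_left_mult[of \<delta> \<one> "\<delta> [^] j"] by (simp add: int_pow_mult)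
    then show False using assms prec_antisym[of \<delta> \<one>] by (simp add: prec_M)
  qed
qed (rule delta_pow_prec)

text \<open>Powers of \<delta> on either side of \<open>x\<close> bound the exponents, so the
  maximum in \<open>garside_inf\<close> is attained. Bounds on the infimum thereby become order
  relations, which interact well with meets.\<close>

lemma prec_inf_iff:
  assumes "\<delta> \<noteq> \<one>" "x \<in> carrier G"
  shows "\<delta> [^] k \<preceq> x \<longleftrightarrow> k \<le> garside_inf G M \<delta> x"
proof -
  obtain a :: int where a: "\<delta> [^] a \<preceq> x" using delta_pow_prec_exists assms(2) .
  obtain b :: int where b: "x \<preceq> \<delta> [^] b" using prec_delta_pow_exists assms(2) .
  have bound: "k \<le> b" if "\<delta> [^] k \<preceq> x" for k :: int
    using prec_trans[OF that b] assms by (simp add: delta_pow_prec_iff)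
  note G = bounded_int_Greatest[of "\<lambda>k. \<delta> [^] k \<preceq> x", OF a bound]
  have "\<delta> [^] k \<preceq> x" if "k \<le> garside_inf G M \<delta> x"
    using prec_trans[OF delta_pow_prec[OF that]] G(1) assms(2) by (simp add: garside_inf_def)
  with G(2)[of k] show ?thesis by (auto simp: garside_inf_def)
qed

lemma prec_sup_iff:
  assumes "\<delta> \<noteq> \<one>" "x \<in> carrier G"
  shows "x \<preceq> \<delta> [^] m \<longleftrightarrow> garside_sup G M \<delta> x \<le> m"
proof -
  obtain a :: int where a: "\<delta> [^] a \<preceq> x" using delta_pow_prec_exists assms(2) .
  obtain b :: int where b: "x \<preceq> \<delta> [^] b" using prec_delta_pow_exists assms(2) .
  have bound: "a \<le> k" if "x \<preceq> \<delta> [^] k" for k :: int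
    using prec_trans[OF a that] assms by (simp add: delta_pow_prec_iff)
  note L = bounded_int_Least[of "\<lambda>k. x \<preceq> \<delta> [^] k", OF b bound]
  have "x \<preceq> \<delta> [^] m" if "garside_sup G M \<delta> x \<le> m"
    using prec_trans[OF _ delta_pow_prec[OF that]] L(1) assms(2) by (simp add: garside_sup_def)
  with L(2)[of m] show ?thesis by (auto simp: garside_sup_def)
qed

section \<open>Cycling and transport\<close>

text \<open>With \<open>k\<close> the infimum of \<open>y\<close> this is the conjugating element of
  cycling. Keeping \<open>k\<close> as an argument gives a formula on all of \<open>G\<close> that
  does not involve normal forms.\<close>

definition cyc_elt where "cyc_elt k y = \<delta> \<and>\<and> (y \<otimes> \<delta> [^] (- k :: int))"

definition cyc where "cyc k y = conjugate G y (cyc_elt k y)"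

lemma cyc_elt_closed [simp]: "y \<in> carrier G \<Longrightarrow> cyc_elt k y \<in> carrier G"
  by (simp add: cyc_elt_def)

lemma cyc_closed [simp]: "y \<in> carrier G \<Longrightarrow> cyc k y \<in> carrier G"
  by (simp add: cyc_def)

lemma conjugate_one [simp]: "y \<in> carrier G \<Longrightarrow> conjugate G y \<one> = y"
  by (simp add: conjugate_def)

lemma delta_pow_commute: "\<delta> [^] (i::int) \<otimes> \<delta> [^] (j::int) = \<delta> [^] j \<otimes> \<delta> [^] i"
  by (simp add: add.commute flip: int_pow_mult)

text \<open>The greedy list of length \<open>garside_len\<close> meets the definition, and
  uniqueness evaluates the \<open>THE\<close>. The head of that list is known from its
  construction.\<close>

lemma normal_form_hd:
  assumes "\<delta> \<noteq> \<one>" "x \<in> carrier G" "garside_len G M \<delta> x \<noteq> 0"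
  shows "hd (normal_form G M \<delta> x) = \<delta> \<and>\<and> (\<delta> [^] (- garside_inf G M \<delta> x) \<otimes> x)"
proof -
  define k where "k = garside_inf G M \<delta> x"
  define m where "m = garside_sup G M \<delta> x"
  define z where "z = \<delta> [^] (- k) \<otimes> x"
  have k: "\<delta> [^] k \<preceq> x" and m: "x \<preceq> \<delta> [^] m"
    using assms prec_inf_iff prec_sup_iff by (simp_all add: k_def m_def)
  have "k \<le> m" using prec_trans[OF k m] assms by (simp add: delta_pow_prec_iff)
  then have r: "int (nat (m - k)) = m - k" "nat (m - k) > 0"
    using assms(3) by (simp_all add: garside_len_def k_def m_def)
  have "z \<in> M" using k by (simp add: z_def prec_def int_pow_neg)
  moreover have "z \<preceq> \<delta> [^] (m - k)"
    using prec_left_mult[of z "\<delta> [^] (m - k)" "\<delta> [^] k"] m assms(2)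
    by (simp add: z_def int_pow_mult_assoc flip: int_pow_mult)
  ultimately obtain As where As: "length As = nat (m - k)" "set As \<subseteq> simples G M \<delta>" "list_prod G As = z"
    "\<forall>i. Suc i < nat (m - k) \<longrightarrow> (inv (As ! i) \<otimes> \<delta>) \<and>\<and> (As ! Suc i) = \<one>" "hd As = \<delta> \<and>\<and> z"
    using normal_form_length_exists[of z "nat (m - k)"] r by auto
  have xz: "x = \<delta> [^] k \<otimes> z" using assms(2) by (simp add: z_def int_pow_mult_assoc)
  have "normal_form G M \<delta> x = As"
    unfolding normal_form_def
  proof (rule the_equality)
    show "is_normal_form G M \<delta> x As"
      unfolding is_normal_form_def garside_len_def k_def[symmetric] m_def[symmetric] gmeet_def[symmetric]
      using As r xz by simp
    fix Bs assume "is_normal_form G M \<delta> x Bs"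
    then have Bs: "int (length Bs) = m - k" "set Bs \<subseteq> simples G M \<delta>" "x = \<delta> [^] k \<otimes> list_prod G Bs"
      "\<And>i. Suc i < length Bs \<Longrightarrow> (inv (Bs ! i) \<otimes> \<delta>) \<and>\<and> (Bs ! Suc i) = \<one>"
      by (simp_all add: is_normal_form_def garside_len_def k_def m_def gmeet_def)
    show "Bs = As"
    proof (rule normal_list_unique)
      show "length Bs = length As" using Bs(1) As(1) by simp
      have "list_prod G Bs \<in> M" using Bs(2) by (intro list_prod_M) auto
      then show "list_prod G Bs = list_prod G As"
        using Bs(3) xz As(3) \<open>z \<in> M\<close> by (simp add: l_cancel)
    qed (use Bs As in auto)
  qed
  then show ?thesis using As(5) by (simp add: z_def k_def)
qed

text \<open>Conjugation by a power of \<delta> is an order automorphism fixing \<delta>, so it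
  carries the head of the normal form to \<open>cyc_elt\<close>. At length zero, \<open>x\<close> is
  \<delta>\<open>[^] k\<close> and the meet collapses to \<open>\<one>\<close>.\<close>

lemma cycling_eq_cyc:
  assumes "\<delta> \<noteq> \<one>" "x \<in> carrier G"
  shows "cycling G M \<delta> x = cyc (garside_inf G M \<delta> x) x"
proof -
  define k where "k = garside_inf G M \<delta> x"
  have k: "\<delta> [^] k \<preceq> x" using assms prec_inf_iff by (simp add: k_def)
  show ?thesis
  proof (cases "garside_len G M \<delta> x = 0")
    case True
    then have "x \<preceq> \<delta> [^] k" using assms prec_sup_iff by (simp add: garside_len_def k_def)
    then have "x = \<delta> [^] k" using k assms by (intro prec_antisym) auto
    moreover have "\<delta> \<and>\<and> \<one> = \<one>"
      by (intro gmeet_eqI) (use prec_trans[of _ \<one> \<delta>] in \<open>auto simp: prec_M\<close>)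
    ultimately have "cyc k x = x" by (simp add: cyc_def cyc_elt_def flip: int_pow_mult)
    then show ?thesis using True by (simp add: cycling_def k_def)
  next
    case False
    have "tau_pow G \<delta> (- k) (\<delta> \<and>\<and> (\<delta> [^] (- k) \<otimes> x))
        = \<delta> [^] k \<otimes> (\<delta> \<and>\<and> (\<delta> [^] (- k) \<otimes> x)) \<otimes> \<delta> [^] (- k)"
      by (simp add: tau_pow_def conjugate_def int_pow_neg)
    also have "\<dots> = ((\<delta> [^] k \<otimes> \<delta>) \<and>\<and> x) \<otimes> \<delta> [^] (- k)"
      using gmeet_left_mult[of \<delta> "\<delta> [^] (- k) \<otimes> x" "\<delta> [^] k"] assms by (simp add: int_pow_mult_assoc)
    also have "\<dots> = (\<delta> [^] k \<otimes> \<delta> \<otimes> \<delta> [^] (- k)) \<and>\<and> (x \<otimes> \<delta> [^] (- k))"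
      using gmeet_delta_pow assms by simp
    also have "\<delta> [^] k \<otimes> \<delta> \<otimes> \<delta> [^] (- k) = \<delta>"
      using delta_pow_commute[of k 1] by (simp add: m_assoc flip: int_pow_mult)
    finally show ?thesis
      using False normal_form_hd[OF assms False] by (simp add: cycling_def cyc_def cyc_elt_def k_def)
  qed
qed

section \<open>Transport along cycling\<close>

definition transport where
  "transport k y u = inv (cyc_elt k y) \<otimes> u \<otimes> cyc_elt k (conjugate G y u)"

lemma transport_closed [simp]:
  "\<lbrakk>y \<in> carrier G; u \<in> carrier G\<rbrakk> \<Longrightarrow> transport k y u \<in> carrier G"
  by (simp add: transport_def)

text \<open>Transport completes a commuting square: cycling \<open>y\<close> and then applying the
  transport conjugates by the same element as applying \<open>u\<close> and then cycling.\<close>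

lemma conjugate_transport:
  assumes "y \<in> carrier G" "u \<in> carrier G"
  shows "conjugate G (cyc k y) (transport k y u) = cyc k (conjugate G y u)"
proof -
  have "cyc_elt k y \<otimes> transport k y u = u \<otimes> cyc_elt k (conjugate G y u)"
    using assms by (simp add: transport_def m_assoc mult_inv_cancel)
  then show ?thesis using assms by (simp add: cyc_def flip: conjugate_mult)
qed

text \<open>In this form, with the exponent \<open>k\<close> independent of \<open>u\<close>, the transport visibly preserves
  meets in \<open>u\<close>.\<close>

lemma transport_eq_meet:
  assumes "y \<in> carrier G" "u \<in> carrier G"
  shows "transport k y u = inv (cyc_elt k y) \<otimes> ((u \<otimes> \<delta>) \<and>\<and> (y \<otimes> u \<otimes> \<delta> [^] (- k)))"
proof -
  have "u \<otimes> cyc_elt k (conjugate G y u) = (u \<otimes> \<delta>) \<and>\<and> (y \<otimes> u \<otimes> \<delta> [^] (- k))"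
    using assms gmeet_left_mult[of \<delta> "conjugate G y u \<otimes> \<delta> [^] (- k)" u]
    by (simp add: cyc_elt_def conjugate_def m_assoc mult_inv_cancel)
  then show ?thesis using assms by (simp add: transport_def m_assoc)
qed

text \<open>Both terms in \<open>transport_eq_meet\<close> commute with meets in \<open>u\<close>,
  since only left multiplications and right multiplications by powers of \<delta> occur. What
  remains is a regrouping of a fourfold meet.\<close>

lemma transport_gmeet:
  assumes "y \<in> carrier G" "u \<in> carrier G" "v \<in> carrier G"
  shows "transport k y (u \<and>\<and> v) = transport k y u \<and>\<and> transport k y v"
proof -
  let ?F = "\<lambda>u. (u \<otimes> \<delta>) \<and>\<and> (y \<otimes> u \<otimes> \<delta> [^] (- k))"
  have "(u \<and>\<and> v) \<otimes> \<delta> = (u \<otimes> \<delta>) \<and>\<and> (v \<otimes> \<delta>)"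
    using gmeet_delta_pow[of u v 1] assms by simp
  moreover have "y \<otimes> (u \<and>\<and> v) \<otimes> \<delta> [^] (- k) = (y \<otimes> u \<otimes> \<delta> [^] (- k)) \<and>\<and> (y \<otimes> v \<otimes> \<delta> [^] (- k))"
    using gmeet_delta_pow[of "y \<otimes> u" "y \<otimes> v" "- k"] gmeet_left_mult[of u v y] assms by simp
  ultimately have "?F u \<and>\<and> ?F v = ?F (u \<and>\<and> v)"
    using assms by (intro gmeet_eqI) (auto simp: prec_gmeet_iff)
  then show ?thesis
    using assms by (simp add: transport_eq_meet gmeet_left_mult)
qed

text \<open>A map that preserves meets is monotone, since \<open>u \<preceq> v\<close> makes
  \<open>u \<and>\<and> v\<close> equal to \<open>u\<close>.\<close>

lemma transport_mono:
  assumes "u \<preceq> v" "y \<in> carrier G" "u \<in> carrier G" "v \<in> carrier G"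
  shows "transport k y u \<preceq> transport k y v"
  using assms transport_gmeet[of y u v k] gmeet_lower(2)[of "transport k y u" "transport k y v"]
  by (simp add: gmeet_absorb)

lemma transport_M:
  assumes "y \<in> carrier G" "u \<in> M"
  shows "transport k y u \<in> M"
proof -
  have "transport k y \<one> = \<one>" using assms by (simp add: transport_def)
  then show ?thesis
    using transport_mono[of \<one> u y k] assms by (simp add: one_prec_iff)
qed

text \<open>The power of \<delta> factors out of the meet on the right. Together with monotonicity,
  this keeps transport within the interval below that power.\<close>

lemma transport_delta_pow:
  assumes "y \<in> carrier G"
  shows "transport k y (\<delta> [^] m) = \<delta> [^] (m :: int)"
proof -
  have "y \<otimes> \<delta> [^] m \<otimes> \<delta> [^] (- k) = y \<otimes> \<delta> [^] (- k) \<otimes> \<delta> [^] m"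
    using assms by (simp add: m_assoc delta_pow_commute[of m])
  moreover have "\<delta> [^] m \<otimes> \<delta> = \<delta> \<otimes> \<delta> [^] m"
    using delta_pow_commute[of m 1] by simp
  ultimately show ?thesis
    using assms gmeet_delta_pow[of \<delta> "y \<otimes> \<delta> [^] (- k)" m]
    by (simp add: transport_eq_meet cyc_elt_def inv_mult_cancel)
qed

text \<open>Transport depends on its base point, which itself moves under cycling, so the pair is
  iterated.\<close>

definition transport_step where
  "transport_step k = (\<lambda>(y, u). (cyc k y, transport k y u))"

lemma funpow_cyc_closed [simp]: "y \<in> carrier G \<Longrightarrow> (cyc k ^^ n) y \<in> carrier G"
  by (induction n) auto

lemma fst_transport_steps: "fst ((transport_step k ^^ n) (y, u)) = (cyc k ^^ n) y"
  by (induction n) (auto simp: transport_step_def split: prod.splits)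

lemma snd_transport_steps_Suc:
  "snd ((transport_step k ^^ Suc n) (y, u))
    = transport k ((cyc k ^^ n) y) (snd ((transport_step k ^^ n) (y, u)))"
proof -
  obtain z w where zw: "(transport_step k ^^ n) (y, u) = (z, w)" by fastforce
  then have "z = (cyc k ^^ n) y" using fst_transport_steps[where k = k and n = n and y = y and u = u] by simp
  with zw show ?thesis by (simp add: transport_step_def[of k])
qed

lemma snd_transport_steps_closed [simp]:
  "\<lbrakk>y \<in> carrier G; u \<in> carrier G\<rbrakk> \<Longrightarrow> snd ((transport_step k ^^ n) (y, u)) \<in> carrier G"
  by (induction n) (simp_all only: snd_transport_steps_Suc, simp_all)

lemma conjugate_transport_steps:
  assumes "y \<in> carrier G" "u \<in> carrier G"
  shows "conjugate G ((cyc k ^^ n) y) (snd ((transport_step k ^^ n) (y, u))) = (cyc k ^^ n) (conjugate G y u)"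
proof (induction n)
  case (Suc n)
  then show ?case
    unfolding snd_transport_steps_Suc
    using assms conjugate_transport[of "(cyc k ^^ n) y" "snd ((transport_step k ^^ n) (y, u))" k]
    by simp
qed simp

lemma transport_steps_gmeet:
  assumes "y \<in> carrier G" "u \<in> carrier G" "v \<in> carrier G"
  shows "snd ((transport_step k ^^ n) (y, u \<and>\<and> v))
    = snd ((transport_step k ^^ n) (y, u)) \<and>\<and> snd ((transport_step k ^^ n) (y, v))"
proof (induction n)
  case (Suc n)
  then show ?case unfolding snd_transport_steps_Suc using assms by (simp add: transport_gmeet)
qed simp

lemma transport_periodic:
  assumes y: "y \<in> carrier G" and u: "u \<in> M"
    and py: "p > 0" "(cyc k ^^ p) y = y"
    and pz: "q > 0" "(cyc k ^^ q) (conjugate G y u) = conjugate G y u"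
  obtains n :: nat where "n > 0" "(transport_step k ^^ n) (y, u) = (y, u)"
proof -
  obtain m :: int where m: "u \<preceq> \<delta> [^] m" using prec_delta_pow_exists[OF mem_carrier[OF u]] .
  define O1 where "O1 = range (\<lambda>i. (cyc k ^^ i) y)"
  define O2 where "O2 = range (\<lambda>i. (cyc k ^^ i) (conjugate G y u))"
  have orbit: "finite O1" "inj_on (cyc k) O1" "inj_on (cyc k) O2"
    using funpow_periodic_orbit[OF py] funpow_periodic_orbit[OF pz] by (simp_all add: O1_def O2_def)
  have "cyc k z \<in> range (\<lambda>i. (cyc k ^^ i) a)" if z: "z \<in> range (\<lambda>i. (cyc k ^^ i) a)" for z a
  proof -
    obtain i where "z = (cyc k ^^ i) a" using z by (rule rangeE)
    then have "cyc k z = (cyc k ^^ Suc i) a" by simp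
    then show ?thesis by (rule range_eqI)
  qed
  then have step: "\<And>z. z \<in> O1 \<Longrightarrow> cyc k z \<in> O1" "\<And>z. z \<in> O2 \<Longrightarrow> cyc k z \<in> O2"
    unfolding O1_def O2_def by simp_all
  have O1: "z \<in> carrier G" if "z \<in> O1" for z
    using that y unfolding O1_def by auto
  \<comment> \<open>Cycling is known to be injective only on periodic orbits, so both ends of the
    conjugation are confined to such orbits. The bound \<delta>\<open>[^] m\<close> makes the set
    finite.\<close>
  define W where "W = {(z, w). z \<in> O1 \<and> w \<in> M \<and> w \<preceq> \<delta> [^] m \<and> conjugate G z w \<in> O2}"
  have "finite W"
    by (rule finite_subset[of _ "O1 \<times> {w \<in> M. w \<preceq> \<delta> [^] m}"])
      (use orbit(1) finite_interval in \<open>auto simp: W_def\<close>)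
  moreover have "inj_on (transport_step k) W"
  proof (rule inj_onI)
    fix a b assume a: "a \<in> W" and b: "b \<in> W" and eq: "transport_step k a = transport_step k b"
    obtain z w z' w' where ab: "a = (z, w)" "b = (z', w')" by (cases a, cases b)
    have z: "z \<in> O1" "z' \<in> O1" "conjugate G z w \<in> O2" "conjugate G z' w' \<in> O2" "w \<in> carrier G" "w' \<in> carrier G"
      using a b ab by (auto simp: W_def)
    have e: "cyc k z = cyc k z'" "transport k z w = transport k z' w'"
      using eq by (simp_all add: ab transport_step_def)
    have "z = z'" using orbit(2) e(1) z(1,2) by (rule inj_onD)
    \<comment> \<open>Equal transports from the same base have the same target after cycling.
      Injectivity on \<open>O2\<close> recovers the target before cycling, so both outer factors of
      the transport agree and cancel.\<close>
    have "cyc k (conjugate G z w) = cyc k (conjugate G z' w')"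
      using e z O1 by (metis conjugate_transport)
    with orbit(3) have "conjugate G z w = conjugate G z' w'" using z(3,4) by (rule inj_onD)
    then have "inv (cyc_elt k z) \<otimes> w \<otimes> cyc_elt k (conjugate G z w)
        = inv (cyc_elt k z) \<otimes> w' \<otimes> cyc_elt k (conjugate G z w)"
      using e(2) \<open>z = z'\<close> by (simp add: transport_def)
    then have "inv (cyc_elt k z) \<otimes> w = inv (cyc_elt k z) \<otimes> w'"
      using z(5,6) O1[OF z(1)] by (simp only: r_cancel monoid.m_closed[OF monoid_axioms] inv_closed cyc_elt_closed conjugate_closed)
    then have "w = w'" using z(5,6) O1[OF z(1)] by (simp only: l_cancel inv_closed cyc_elt_closed)
    with \<open>z = z'\<close> ab show "a = b" by simp
  qed
  moreover have "transport_step k ` W \<subseteq> W"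
  proof
    fix b assume "b \<in> transport_step k ` W"
    then obtain a where "a \<in> W" "b = transport_step k a" by (elim imageE)
    then obtain z w where b: "b = (cyc k z, transport k z w)" and zw: "(z, w) \<in> W"
      by (cases a) (simp add: transport_step_def)
    from zw have z: "z \<in> O1" "w \<in> M" "w \<preceq> \<delta> [^] m" "conjugate G z w \<in> O2"
      by (auto simp: W_def)
    have zG: "z \<in> carrier G" using O1 z(1) .
    have "transport k z w \<preceq> \<delta> [^] m"
      using transport_mono[OF z(3) zG, of k] z(2) by (simp add: transport_delta_pow zG)
    then show "b \<in> W"
      using b z zG step by (simp add: W_def transport_M conjugate_transport)
  qed
  moreover have "(y, u) \<in> W"
    using u m rangeI[of "\<lambda>i. (cyc k ^^ i) y" 0] rangeI[of "\<lambda>i. (cyc k ^^ i) (conjugate G y u)" 0]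
    by (simp add: W_def O1_def O2_def)
  ultimately obtain n :: nat where "n > 0" "(transport_step k ^^ n) (y, u) = (y, u)"
    by (rule funpow_returns)
  then show ?thesis by (rule that)
qed

lemma gmeet_periodic:
  assumes y: "y \<in> carrier G" and u: "u \<in> M" and v: "v \<in> M"
    and "p > 0" "(cyc k ^^ p) y = y"
    and "q > 0" "(cyc k ^^ q) (conjugate G y u) = conjugate G y u"
    and "r > 0" "(cyc k ^^ r) (conjugate G y v) = conjugate G y v"
  obtains n :: nat where "n > 0" "(cyc k ^^ n) (conjugate G y (u \<and>\<and> v)) = conjugate G y (u \<and>\<and> v)"
proof -
  obtain n1 where n1: "n1 > 0" "(transport_step k ^^ n1) (y, u) = (y, u)"
    using transport_periodic[of y u p k q] assms by blast
  obtain n2 where n2: "n2 > 0" "(transport_step k ^^ n2) (y, v) = (y, v)"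
    using transport_periodic[of y v p k r] assms by blast
  \<comment> \<open>A common multiple of the two periods returns both pairs at once. The first
    components show that it is also a period of \<open>y\<close>.\<close>
  define n where "n = n1 * n2"
  have nu: "(transport_step k ^^ n) (y, u) = (y, u)" and nv: "(transport_step k ^^ n) (y, v) = (y, v)"
    unfolding n_def by (rule funpow_mult_fixed, rule n1 n2)+
  have "(cyc k ^^ n) y = y" using fst_transport_steps[of n k y u] nu by simp
  moreover have "snd ((transport_step k ^^ n) (y, u \<and>\<and> v)) = u \<and>\<and> v"
    using transport_steps_gmeet[of y u v n k] y u v nu nv by simp
  ultimately have "(cyc k ^^ n) (conjugate G y (u \<and>\<and> v)) = conjugate G y (u \<and>\<and> v)"
    using conjugate_transport_steps[of y "u \<and>\<and> v" n k] y u v by simp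
  moreover have "n > 0" using n1 n2 by (simp add: n_def)
  ultimately show ?thesis using that by blast
qed

section \<open>Summit sets\<close>

lemma conjugates_closed: "\<lbrakk>x \<in> carrier G; y \<in> conjugates G x\<rbrakk> \<Longrightarrow> y \<in> carrier G"
  by (auto simp: conjugates_def)

lemma conjugates_conjugate:
  assumes "x \<in> carrier G" "y \<in> conjugates G x" "c \<in> carrier G"
  shows "conjugate G y c \<in> conjugates G x"
proof -
  obtain d where "d \<in> carrier G" "y = conjugate G x d"
    using assms(2) unfolding conjugates_def by blast
  then have "d \<otimes> c \<in> carrier G" "conjugate G y c = conjugate G x (d \<otimes> c)"
    using assms by (simp_all add: conjugate_mult)
  then show ?thesis unfolding conjugates_def by blast
qed

text \<open>Multiplying by \<open>w\<close> on the left removes \<open>inv w\<close>. In the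
  resulting inequality both sides commute with meets in \<open>w\<close>.\<close>

lemma delta_pow_prec_conjugate:
  assumes "y \<in> carrier G" "w \<in> carrier G"
  shows "\<delta> [^] (k::int) \<preceq> conjugate G y w \<longleftrightarrow> w \<otimes> \<delta> [^] k \<preceq> y \<otimes> w"
  using prec_left_mult[of "\<delta> [^] k" "conjugate G y w" w] assms
  by (simp add: conjugate_def m_assoc mult_inv_cancel)

lemma conjugate_prec_delta_pow:
  assumes "y \<in> carrier G" "w \<in> carrier G"
  shows "conjugate G y w \<preceq> \<delta> [^] (m::int) \<longleftrightarrow> y \<otimes> w \<preceq> w \<otimes> \<delta> [^] m"
  using prec_left_mult[of "conjugate G y w" "\<delta> [^] m" w] assms
  by (simp add: conjugate_def m_assoc mult_inv_cancel)

context
  fixes x y k m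
  assumes delta: "\<delta> \<noteq> \<one>" and x: "x \<in> carrier G" and y: "y \<in> super_summit_set G M \<delta> x"
    and k: "k = garside_inf G M \<delta> y" and m: "m = garside_sup G M \<delta> y"
begin

text \<open>The values \<open>k\<close> and \<open>m\<close> attained at \<open>y\<close> are
  optimal among the conjugates of \<open>x\<close>, so reaching them amounts to lying in an interval
  between powers of \<delta>.\<close>

lemma super_summit_iff:
  "z \<in> super_summit_set G M \<delta> x \<longleftrightarrow> z \<in> conjugates G x \<and> \<delta> [^] k \<preceq> z \<and> z \<preceq> \<delta> [^] m"
proof -
  have bound: "garside_inf G M \<delta> z \<le> k" "m \<le> garside_sup G M \<delta> z" if "z \<in> conjugates G x" for z
    using y that by (simp_all add: super_summit_set_def k m)
  have "z \<in> super_summit_set G M \<delta> x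
      \<longleftrightarrow> z \<in> conjugates G x \<and> k \<le> garside_inf G M \<delta> z \<and> garside_sup G M \<delta> z \<le> m"
  proof
    assume "z \<in> super_summit_set G M \<delta> x"
    then show "z \<in> conjugates G x \<and> k \<le> garside_inf G M \<delta> z \<and> garside_sup G M \<delta> z \<le> m"
      using y by (simp add: super_summit_set_def k m)
  next
    assume z: "z \<in> conjugates G x \<and> k \<le> garside_inf G M \<delta> z \<and> garside_sup G M \<delta> z \<le> m"
    have "garside_inf G M \<delta> w \<le> garside_inf G M \<delta> z \<and> garside_sup G M \<delta> z \<le> garside_sup G M \<delta> w"
      if "w \<in> conjugates G x" for w
      using z bound[OF that] by linarith
    with z show "z \<in> super_summit_set G M \<delta> x" by (simp add: super_summit_set_def)
  qed
  then show ?thesis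
    using prec_inf_iff[OF delta conjugates_closed[OF x], of z k]
      prec_sup_iff[OF delta conjugates_closed[OF x], of z m] by blast
qed

lemma super_summit_inf:
  assumes "z \<in> super_summit_set G M \<delta> x"
  shows "garside_inf G M \<delta> z = k"
proof (rule antisym)
  show "garside_inf G M \<delta> z \<le> k" "k \<le> garside_inf G M \<delta> z"
    using assms y by (simp_all add: super_summit_set_def k)
qed

lemma super_summit_carrier: "z \<in> super_summit_set G M \<delta> x \<Longrightarrow> z \<in> carrier G"
  using conjugates_closed[OF x] by (simp add: super_summit_set_def)

text \<open>For \<open>u\<close> and for \<open>v\<close>, membership amounts to inequalities
  between expressions that commute with meets. Taking the meet of the inequalities for
  \<open>u\<close> and \<open>v\<close> gives those for \<open>u \<and>\<and> v\<close>.\<close>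

lemma super_summit_gmeet:
  assumes z: "z \<in> super_summit_set G M \<delta> x" and uv: "u \<in> carrier G" "v \<in> carrier G"
    and "conjugate G z u \<in> super_summit_set G M \<delta> x" "conjugate G z v \<in> super_summit_set G M \<delta> x"
  shows "conjugate G z (u \<and>\<and> v) \<in> super_summit_set G M \<delta> x"
proof -
  have zG [simp]: "z \<in> carrier G" using super_summit_carrier z .
  have "u \<otimes> \<delta> [^] k \<preceq> z \<otimes> u" "v \<otimes> \<delta> [^] k \<preceq> z \<otimes> v" "z \<otimes> u \<preceq> u \<otimes> \<delta> [^] m" "z \<otimes> v \<preceq> v \<otimes> \<delta> [^] m"
    using assms(4,5) uv by (simp_all add: super_summit_iff delta_pow_prec_conjugate conjugate_prec_delta_pow)
  moreover have "a \<and>\<and> b \<preceq> c \<and>\<and> d"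
    if "a \<preceq> c" "b \<preceq> d" "a \<in> carrier G" "b \<in> carrier G" "c \<in> carrier G" "d \<in> carrier G" for a b c d
    using prec_trans[OF gmeet_lower(1) that(1)] prec_trans[OF gmeet_lower(2) that(2)] that
    by (simp add: prec_gmeet_iff)
  ultimately have "(u \<and>\<and> v) \<otimes> \<delta> [^] k \<preceq> z \<otimes> (u \<and>\<and> v)" "z \<otimes> (u \<and>\<and> v) \<preceq> (u \<and>\<and> v) \<otimes> \<delta> [^] m"
    using uv by (simp_all flip: gmeet_delta_pow gmeet_left_mult)
  moreover have "conjugate G z (u \<and>\<and> v) \<in> conjugates G x"
    using conjugates_conjugate[OF x] z uv by (simp add: super_summit_set_def)
  ultimately show ?thesis
    using uv by (simp add: super_summit_iff delta_pow_prec_conjugate conjugate_prec_delta_pow)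
qed

text \<open>Conjugation by a power of \<delta> preserves the order and fixes every power of
  \<delta>, hence both bounds persist.\<close>

lemma super_summit_delta_pow:
  assumes z: "z \<in> super_summit_set G M \<delta> x"
  shows "conjugate G z (\<delta> [^] (j::int)) \<in> super_summit_set G M \<delta> x"
proof -
  have zG [simp]: "z \<in> carrier G" using super_summit_carrier z .
  have "conjugate G z (\<delta> [^] j) \<in> conjugates G x"
    using conjugates_conjugate[OF x] z by (simp add: super_summit_set_def)
  then show ?thesis
    using z by (simp add: super_summit_iff delta_pow_prec_conjugate conjugate_prec_delta_pow
        delta_pow_commute[of j] prec_delta_pow)
qed

text \<open>Conjugation by \<open>\<delta>\<close> and by \<open>z\<delta>\<^sup>-\<^sup>k\<close> stays in the super summit set, hence so does
  conjugation by their meet.\<close>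

lemma super_summit_cyc:
  assumes z: "z \<in> super_summit_set G M \<delta> x"
  shows "cyc k z \<in> super_summit_set G M \<delta> x"
proof -
  have zG [simp]: "z \<in> carrier G" using super_summit_carrier z .
  \<comment> \<open>Conjugating \<open>z\<close> by itself has no effect, so only the power of
    \<delta> acts.\<close>
  have "conjugate G z (z \<otimes> \<delta> [^] (- k)) = conjugate G z (\<delta> [^] (- k))"
    by (simp add: conjugate_mult) (simp add: conjugate_def)
  then show ?thesis
    unfolding cyc_def cyc_elt_def
    using super_summit_delta_pow[OF z, of 1] super_summit_delta_pow[OF z, of "- k"]
    by (intro super_summit_gmeet z) simp_all
qed

text \<open>The orbit never leaves the super summit set, where the infimum is constantly
  \<open>k\<close>, so a single exponent serves for all iterates.\<close>

lemma funpow_cycling_eq_cyc: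
  assumes "z \<in> super_summit_set G M \<delta> x"
  shows "(cycling G M \<delta> ^^ n) z = (cyc k ^^ n) z"
proof -
  have "(cyc k ^^ n) z \<in> super_summit_set G M \<delta> x" for n
    using assms by (induction n) (auto intro: super_summit_cyc)
  then show ?thesis
    by (induction n) (simp_all add: cycling_eq_cyc delta super_summit_carrier super_summit_inf)
qed

end

text \<open>For \<open>\<delta> = \<one>\<close> the infimum and supremum are junk values, but then \<open>M\<close> is trivial.\<close>

lemma ultra_summit_gmeet:
  assumes x: "x \<in> carrier G" and y: "y \<in> ultra_summit_set G M \<delta> x" and uv: "u \<in> M" "v \<in> M"
    and yu: "conjugate G y u \<in> ultra_summit_set G M \<delta> x"
    and yv: "conjugate G y v \<in> ultra_summit_set G M \<delta> x"
  shows "conjugate G y (u \<and>\<and> v) \<in> ultra_summit_set G M \<delta> x"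
proof (cases "\<delta> = \<one>")
  case True
  have M: "a = \<one>" if "a \<in> M" for a
    using that
  proof (induction a rule: M_simples_induct)
    case (mult s b)
    then have "s \<in> M" "s \<preceq> \<one>" using True unfolding simples_eq by auto
    then have "s = \<one>" by (intro prec_antisym) (simp_all add: prec_M)
    with mult show ?case by simp
  qed simp
  have "u \<and>\<and> v = \<one>" using M gmeet_M uv by blast
  moreover have "y \<in> carrier G"
    using y conjugates_closed[OF x] by (simp add: ultra_summit_set_def super_summit_set_def)
  ultimately show ?thesis using y by simp
next
  case False
  define k where "k = garside_inf G M \<delta> y"
  have S: "y \<in> super_summit_set G M \<delta> x" "conjugate G y u \<in> super_summit_set G M \<delta> x"
    "conjugate G y v \<in> super_summit_set G M \<delta> x"
    using y yu yv by (simp_all add: ultra_summit_set_def)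
  \<comment> \<open>All elements concerned lie in one super summit set, so their periodicity under
    cycling can be stated with the same map \<open>cyc k\<close>, as transport requires.\<close>
  note cyc = funpow_cycling_eq_cyc[OF False x S(1) k_def refl]
  have periodic: "\<exists>n::nat. n > 0 \<and> (cyc k ^^ n) z = z" if "z \<in> ultra_summit_set G M \<delta> x" for z
    using that cyc[of z] by (simp add: ultra_summit_set_def)
  have "y \<in> carrier G" using super_summit_carrier[OF False x S(1) k_def refl S(1)] .
  then obtain n :: nat where n: "n > 0" "(cyc k ^^ n) (conjugate G y (u \<and>\<and> v)) = conjugate G y (u \<and>\<and> v)"
    using periodic[OF y] periodic[OF yu] periodic[OF yv] gmeet_periodic[OF _ uv] by blast
  have "conjugate G y (u \<and>\<and> v) \<in> super_summit_set G M \<delta> x"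
    using super_summit_gmeet[OF False x S(1) k_def refl S(1) _ _ S(2,3)] uv by simp
  then show ?thesis using n cyc by (auto simp: ultra_summit_set_def)
qed

end

theorem theorem1p17:
  fixes G :: "('a, 'b) monoid_scheme" and M :: "'a set" and \<delta> x y u v :: 'a
  assumes "garside_group G M \<delta>"
    and "x \<in> carrier G"
    and "y \<in> ultra_summit_set G M \<delta> x"
    and "u \<in> M" and "v \<in> M"
    and "conjugate G y u \<in> ultra_summit_set G M \<delta> x"
    and "conjugate G y v \<in> ultra_summit_set G M \<delta> x"
  shows "conjugate G y (u \<sqinter>\<^bsub>prefix_order G M\<^esub> v) \<in> ultra_summit_set G M \<delta> x"
proof -
  interpret garside_group G M \<delta> by fact
  show ?thesis using ultra_summit_gmeet[OF assms(2-7)] by (simp add: gmeet_def)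
qed

end
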